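(* The Identity Correspondence Problem is undecidable, already over the binary group alphabet $\{a,b,a^{-1},b^{-1}\}$ and for instances consisting of $m=48$ pairs of words. More precisely, it is undecidable for $m=8(n-1)$ where $n$ is any number of pairs for which Restricted PCP is undecidable (e.g. $n=7$).
   Context: $F(\{a,b\})$ denotes the free group on $\{a,b\}$, whose elements are reduced words over $\{a,b,a^{-1},b^{-1}\}$; $\varepsilon$ denotes the empty word (identity). Identity Correspondence Problem (ICP): given a finite set $\Pi=\{(s_1,t_1),\ldots,(s_m,t_m)\}\subseteq F(\{a,b\})\times F(\{a,b\})$, decide whether there exists a nonempty finite sequence of indices $l_1,\ldots,l_k$ with $1\le l_i\le m$ such that $s_{l_1}s_{l_2}\cdots s_{l_k}=t_{l_1}t_{l_2}\cdots t_{l_k}=\varepsilon$. Restricted PCP: given $P=\{(u_1,v_1),\ldots,(u_n,v_n)\}\subseteq\{a,b\}^*\times\{a,b\}^*$ with $n\ge3$, decide whether there is a finite sequence $l_1,\ldots,l_k$ with $2\le l_i\le n-1$ such that $u_1u_{l_1}\cdots u_{l_k}u_n=v_1v_{l_1}\cdots v_{l_k}v_n$; this is known to be undecidable for $n=7$. *)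

theory Defs
  imports Main "HOL-Library.Nat_Bijection"
begin

datatype recf =
    Z
  | S
  | Id nat
  | Cn recf "recf list"
  | Pr recf recf
  | Mn recf

inductive eval :: "recf \<Rightarrow> nat list \<Rightarrow> nat \<Rightarrow> bool" where
  eval_Z: "eval Z xs 0"
| eval_S: "eval S [x] (Suc x)"
| eval_Id: "i < length xs \<Longrightarrow> eval (Id i) xs (xs ! i)"
| eval_Cn: "length ys = length gs \<Longrightarrow> (\<forall>i < length gs. eval (gs ! i) xs (ys ! i))
            \<Longrightarrow> eval f ys y \<Longrightarrow> eval (Cn f gs) xs y"
| eval_Pr0: "eval f xs y \<Longrightarrow> eval (Pr f g) (0 # xs) y"
| eval_PrS: "eval (Pr f g) (k # xs) y \<Longrightarrow> eval g (y # k # xs) z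
            \<Longrightarrow> eval (Pr f g) (Suc k # xs) z"
| eval_Mn: "eval f (k # xs) 0 \<Longrightarrow> (\<forall>j < k. \<exists>y. eval f (j # xs) y \<and> 0 < y)
            \<Longrightarrow> eval (Mn f) xs k"

definition decidable_on :: "('a \<Rightarrow> nat) \<Rightarrow> 'a set \<Rightarrow> ('a \<Rightarrow> bool) \<Rightarrow> bool" where
  "decidable_on enc D Y \<longleftrightarrow>
     (\<exists>f. \<forall>x \<in> D. eval f [enc x] (if Y x then 1 else 0))"

datatype gen = a | b

text \<open>A group letter is a generator together with a flag: (g, False) is g, (g, True) is g^-1.\<close>
type_synonym letter = "gen \<times> bool"

definition inv_letter :: "letter \<Rightarrow> letter" where
  "inv_letter x = (fst x, \<not> snd x)"

definition reduced :: "letter list \<Rightarrow> bool" where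
  "reduced w \<longleftrightarrow> (\<forall>i. Suc i < length w \<longrightarrow> w ! Suc i \<noteq> inv_letter (w ! i))"

fun red :: "letter list \<Rightarrow> letter list" where
  "red [] = []"
| "red (x # w) = (case red w of
                    [] \<Rightarrow> [x]
                  | y # v \<Rightarrow> (if y = inv_letter x then v else x # y # v))"

text \<open>Elements of F({a,b}) are reduced words; the product of elements u_1,...,u_k is
  red (u_1 @ ... @ u_k); the identity is the empty word.\<close>

type_synonym icp_instance = "(letter list \<times> letter list) list"

definition icp_instances :: "nat \<Rightarrow> icp_instance set" where
  "icp_instances m = {\<Pi>. length \<Pi> = m \<and> (\<forall>p \<in> set \<Pi>. reduced (fst p) \<and> reduced (snd p))}"

definition ICP :: "icp_instance \<Rightarrow> bool" where
  "ICP \<Pi> \<longleftrightarrow> (\<exists>ls. ls \<noteq> [] \<and> (\<forall>l \<in> set ls. l < length \<Pi>) \<and>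
      red (concat (map (\<lambda>l. fst (\<Pi> ! l)) ls)) = [] \<and>
      red (concat (map (\<lambda>l. snd (\<Pi> ! l)) ls)) = [])"

type_synonym pcp_instance = "(gen list \<times> gen list) list"

definition pcp_instances :: "nat \<Rightarrow> pcp_instance set" where
  "pcp_instances n = {P. length P = n}"

text \<open>Pairs are indexed 0..n-1 (the paper's 1..n); the first pair is P!0, the last is
  P!(n-1), and the intermediate indices range over 1..n-2.\<close>
definition RPCP :: "pcp_instance \<Rightarrow> bool" where
  "RPCP P \<longleftrightarrow> (\<exists>ls. (\<forall>l \<in> set ls. 1 \<le> l \<and> l \<le> length P - 2) \<and>
      fst (P ! 0) @ concat (map (\<lambda>l. fst (P ! l)) ls) @ fst (P ! (length P - 1)) =
      snd (P ! 0) @ concat (map (\<lambda>l. snd (P ! l)) ls) @ snd (P ! (length P - 1)))"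

definition enc_gen :: "gen \<Rightarrow> nat" where
  "enc_gen g = (case g of a \<Rightarrow> 0 | b \<Rightarrow> 1)"

definition enc_letter :: "letter \<Rightarrow> nat" where
  "enc_letter x = prod_encode (enc_gen (fst x), if snd x then 1 else 0)"

definition enc_pcp :: "pcp_instance \<Rightarrow> nat" where
  "enc_pcp P = list_encode (map (\<lambda>(u, v). prod_encode (list_encode (map enc_gen u),
                                                       list_encode (map enc_gen v))) P)"

definition enc_icp :: "icp_instance \<Rightarrow> nat" where
  "enc_icp \<Pi> = list_encode (map (\<lambda>(s, t). prod_encode (list_encode (map enc_letter s),
                                                       list_encode (map enc_letter t))) \<Pi>)"

end

(* Every PCP word is coded in four disjoint copies of an alphabet. A tile sequence whose product is
   trivial runs cyclically through the copies; one complete visit of copy k contributes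
   u_1 u_I u_n (v_1 v_J v_n)^-1 to the first component and the index word I J^-1 to the second one, so
   a visit trivial in both components is a solution. As neighbouring visits lie in different free
   factors and two visits of the same copy are at least three visits apart, cancellation in either
   component forces more than half of the complete visits to be trivial in it, up to a correction by
   the number of places where border letters of adjacent tiles do not match. In the
   second component a product of index letters is trivial only after a passage through all copies, so
   there each mismatch increases the number of trivial visits; this outweighs the correction in the
   first component, and some visit is trivial in both. *)

theory Submission
  imports Defs
begin

section \<open>Words in free groups\<close>

text \<open>Cancellation is modelled as rewriting of item lists: fitting neighbours are joined,
  trivial items are deleted, and \<open>score\<close> never increases. This forces the constants.
  With r copies, a gap between two visits of one copy accounts for r - 1 vanished visits; two
  nontrivial complete visits may merge across it into a trivial one, which requires 1 \<le> -1 + (r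
  - 1) - 1. Hence r = 4 and the value 3 of a wound item. A mismatch weighs m = 1 in the first
  component and m = -1 in the second, so mismatches drop out of the sum of the two scores. The
  weight -1 is affordable only because an item that becomes trivial inside one copy is wound, and 3
  - 1 - 1 \<ge> 1. Exponent sums of index letters guarantee this; words of the instance may be
  empty, so the first component offers no such guarantee and has to use the weight 1. The
  combinatorics takes place over countably many generators; \<open>emb\<close> carries it into rank
  two.\<close>

definition push :: "'x \<times> bool \<Rightarrow> ('x \<times> bool) list \<Rightarrow> ('x \<times> bool) list" where
  "push x w = (case w of [] \<Rightarrow> [x] | y # v \<Rightarrow> (if y = (fst x, \<not> snd x) then v else x # w))"

definition fred :: "('x \<times> bool) list \<Rightarrow> ('x \<times> bool) list" where
  "fred w = foldr push w []"

lemma fred_Nil [simp]: "fred [] = []"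
  by (simp add: fred_def)

lemma fred_Cons: "fred (x # w) = push x (fred w)"
  by (simp add: fred_def)

lemma fred_append: "fred (u @ v) = foldr push u (fred v)"
  by (simp add: fred_def)

lemma red_eq_fred: "red = fred"
proof
  fix w show "red w = fred w"
    by (induction w) (auto simp: fred_Cons push_def inv_letter_def split: list.split)
qed

abbreviation cancel_free :: "('x \<times> bool) list \<Rightarrow> bool" where
  "cancel_free \<equiv> successively (\<lambda>x y. y \<noteq> (fst x, \<not> snd x))"

lemma cancel_free_push: "cancel_free w \<Longrightarrow> cancel_free (push x w)"
  by (cases w) (auto simp: push_def successively_Cons)

lemma cancel_free_fred: "cancel_free (fred w)"
  by (induction w) (auto simp: fred_Cons cancel_free_push)

lemma fred_id: "cancel_free w \<Longrightarrow> fred w = w"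
  by (induction w) (auto simp: fred_Cons push_def successively_Cons split: list.split)

lemma reduced_iff: "reduced w \<longleftrightarrow> cancel_free w"
  by (auto simp: reduced_def successively_conv_nth inv_letter_def)

lemma reduced_red: "reduced (red w)"
  by (simp add: reduced_iff red_eq_fred cancel_free_fred)

lemma push_push_inverse: "cancel_free w \<Longrightarrow> push x (push (fst x, \<not> snd x) w) = w"
  by (cases w) (auto simp: push_def successively_Cons split: list.split)

lemma fred_cancel: "fred (x # (fst x, \<not> snd x) # w) = fred w"
  by (simp add: fred_Cons push_push_inverse cancel_free_fred)

text \<open>Letters act on reduced words by \<open>push\<close>, and inverse letters act by inverse
  maps, so a word and its reduction act alike. This replaces a confluence argument for free
  reduction.\<close>

lemma foldr_push: "cancel_free w \<Longrightarrow> foldr push (fred u) w = foldr push u w"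
proof (induction u)
  case (Cons x u)
  have cf: "cancel_free (foldr push v w)" for v
    using Cons.prems by (induction v) (auto simp: cancel_free_push)
  show ?case
  proof (cases "fred u")
    case Nil
    then have "foldr push u w = w" using Cons.IH[OF Cons.prems] by simp
    then show ?thesis using Nil by (simp add: fred_Cons push_def[of x "[]"])
  next
    case (Cons y v)
    show ?thesis
    proof (cases "y = (fst x, \<not> snd x)")
      case True
      then have "foldr push u w = push y (foldr push v w)"
        using Cons Cons.IH Cons.prems by simp
      moreover have "push x (y # v) = v" using True by (simp add: push_def)
      ultimately show ?thesis using True Cons push_push_inverse[OF cf, of x v]
        by (simp add: fred_Cons)
    next
      case False
      then show ?thesis using Cons Cons.IH Cons.prems
        by (simp add: fred_Cons push_def[of x "y # v"])
    qed
  qed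
qed simp

lemma fred_append_fred_left: "fred (fred u @ v) = fred (u @ v)"
  by (simp add: fred_append foldr_push cancel_free_fred)

lemma fred_fred [simp]: "fred (fred u) = fred u"
  by (simp add: fred_id cancel_free_fred)

lemma fred_append_fred_right: "fred (u @ fred v) = fred (u @ v)"
  by (simp add: fred_append)

lemma fred_append_cong: "fred u = fred u' \<Longrightarrow> fred v = fred v' \<Longrightarrow> fred (u @ v) = fred (u' @ v')"
  by (metis fred_append_fred_left fred_append_fred_right)

lemma fred_concat_cong:
  "(\<And>x. x \<in> set xs \<Longrightarrow> fred (f x) = fred (g x)) \<Longrightarrow>
   fred (concat (map f xs)) = fred (concat (map g xs))"
  by (induction xs) (auto intro: fred_append_cong)

lemma fred_drop_mid: "fred v = [] \<Longrightarrow> fred (u @ v @ w) = fred (u @ w)"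
  by (metis append_Nil fred_Nil fred_append_cong)

definition winv :: "('x \<times> bool) list \<Rightarrow> ('x \<times> bool) list" where
  "winv w = rev (map (\<lambda>x. (fst x, \<not> snd x)) w)"

lemma winv_append: "winv (u @ v) = winv v @ winv u"
  by (simp add: winv_def)

lemma winv_winv [simp]: "winv (winv w) = w"
  by (simp add: winv_def rev_map comp_def)

lemma fred_winv_right: "fred (w @ winv w) = []"
proof (induction w rule: rev_induct)
  case (snoc x w)
  have "fred ((w @ [x]) @ winv (w @ [x])) = fred (w @ [x, (fst x, \<not> snd x)] @ winv w)"
    by (simp add: winv_def)
  also have "\<dots> = fred (w @ winv w)"
    by (rule fred_drop_mid) (simp add: fred_cancel)
  finally show ?case using snoc by simp
qed (simp add: winv_def)

lemma fred_winv_left: "fred (winv w @ w) = []"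
  using fred_winv_right[of "winv w"] by simp

definition pos :: "'x list \<Rightarrow> ('x \<times> bool) list" where
  "pos xs = map (\<lambda>x. (x, False)) xs"

lemma pos_append: "pos (xs @ ys) = pos xs @ pos ys"
  by (simp add: pos_def)

lemma fred_pos: "fred (pos xs) = pos xs"
  by (rule fred_id) (simp add: pos_def successively_conv_nth)

text \<open>Positive words are already reduced, so two of them that are equal in the free group are
  equal as words.\<close>

lemma pos_winv_pos_trivial:
  assumes "fred (pos xs @ winv (pos ys)) = []"
  shows "xs = ys"
proof -
  have "fred (pos xs) = fred (pos xs @ winv (pos ys) @ pos ys)"
    using fred_append_cong[of "pos xs" "pos xs" "[]" "winv (pos ys) @ pos ys"]
    by (simp add: fred_winv_left)
  also have "\<dots> = fred (pos ys)"
    using fred_append_cong[OF trans[OF assms fred_Nil[symmetric]], of "pos ys" "pos ys"] by simp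
  finally have "map fst (pos xs) = map fst (pos ys)"
    by (simp add: fred_pos)
  then show ?thesis by (simp add: pos_def comp_def)
qed

text \<open>The exponent sum, a homomorphism to the integers: a nonzero value certifies that a word
  is nontrivial.\<close>

definition esum :: "('x \<times> bool) list \<Rightarrow> int" where
  "esum w = (\<Sum>x\<leftarrow>w. if snd x then - 1 else 1)"

lemma esum_simps [simp]:
  "esum [] = 0" "esum (x # w) = (if snd x then - 1 else 1) + esum w" "esum (u @ v) = esum u + esum v"
  by (simp_all add: esum_def)

lemma esum_fred: "esum (fred w) = esum w"
proof (induction w)
  case (Cons x w)
  have "esum (push x v) = esum (x # v)" for v
    by (cases v) (auto simp: push_def)
  then show ?case using Cons by (simp add: fred_Cons)
qed simp

lemma set_push: "set (push x w) \<subseteq> insert x (set w)"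
  by (cases w) (auto simp: push_def)

lemma set_fred: "set (fred w) \<subseteq> set w"
proof (induction w)
  case (Cons x w)
  then show ?case using set_push[of x "fred w"] by (auto simp: fred_Cons)
qed simp

lemma successively_concat:
  assumes "\<And>w. w \<in> set ws \<Longrightarrow> w \<noteq> [] \<and> successively R w"
    and "successively (\<lambda>u v. R (last u) (hd v)) ws"
  shows "successively R (concat ws)"
  using assms
proof (induction ws)
  case (Cons w ws)
  then show ?case
    by (cases ws) (auto simp: successively_append_iff)
qed simp

subsection \<open>Embedding a free group of countable rank\<close>

text \<open>The classical free basis a^i b a^-i of a subgroup of infinite rank; the flag of the
  letter becomes the sign of b.\<close>

definition emb1 :: "nat \<times> bool \<Rightarrow> letter list" where
  "emb1 x = replicate (fst x) (a, False) @ (b, snd x) # replicate (fst x) (a, True)"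

definition emb :: "(nat \<times> bool) list \<Rightarrow> letter list" where
  "emb w = concat (map emb1 w)"

lemma emb_append: "emb (u @ v) = emb u @ emb v"
  by (simp add: emb_def)

lemma emb_concat: "emb (concat ws) = concat (map emb ws)"
  by (induction ws) (auto simp: emb_def)

lemma emb1_inverse: "emb1 (fst x, \<not> snd x) = winv (emb1 x)"
  by (simp add: emb1_def winv_def)

lemma fred_emb: "fred (emb (fred w)) = fred (emb w)"
proof (induction w)
  case (Cons x w)
  have "fred (emb (push x v)) = fred (emb1 x @ emb v)" for v
  proof (cases v)
    case (Cons y v')
    have "fred (emb v') = fred (emb1 x @ emb1 (fst x, \<not> snd x) @ emb v')"
      using fred_drop_mid[of "emb1 x @ emb1 (fst x, \<not> snd x)" "[]"]
      by (simp add: emb1_inverse fred_winv_right)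
    then show ?thesis using Cons by (auto simp: push_def emb_def)
  qed (auto simp: push_def emb_def)
  then show ?case
    using Cons fred_append_cong[OF refl, of "emb (fred w)" "emb w" "emb1 x"]
    by (simp add: fred_Cons emb_def)
qed simp

text \<open>The free group on two generators acts on pairs of a cursor and a reduced word: the generator
  a moves the cursor and b multiplies by the letter under the cursor. The action recovers a word
  from its image under the embedding.\<close>

fun cursor_step :: "letter \<Rightarrow> int \<times> (nat \<times> bool) list \<Rightarrow> int \<times> (nat \<times> bool) list" where
  "cursor_step (a, e) (i, w) = (if e then i - 1 else i + 1, w)"
| "cursor_step (b, e) (i, w) = (i, push (nat (- i), e) w)"

lemma cursor_step_inverse:
  "cancel_free (snd s) \<Longrightarrow> cursor_step x (cursor_step (fst x, \<not> snd x) s) = s"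
  by (induction x s rule: cursor_step.induct)
    (use push_push_inverse[of _ "(nat (- _), _)"] in auto)

lemma cancel_free_cursor_step: "cancel_free (snd s) \<Longrightarrow> cancel_free (snd (cursor_step x s))"
  by (induction x s rule: cursor_step.induct) (auto simp: cancel_free_push)

lemma cancel_free_cursor: "cancel_free (snd s) \<Longrightarrow> cancel_free (snd (foldr cursor_step w s))"
  by (induction w) (auto simp: cancel_free_cursor_step)

lemma cursor_fred:
  assumes "cancel_free (snd s)"
  shows "foldr cursor_step (fred w) s = foldr cursor_step w s"
proof (induction w)
  case (Cons x w)
  have "foldr cursor_step (push x v) s = cursor_step x (foldr cursor_step v s)" for v
  proof (cases v)
    case (Cons y v')
    then show ?thesis
      using cursor_step_inverse[OF cancel_free_cursor[OF assms], of x v']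
      by (auto simp: push_def)
  qed (simp add: push_def)
  then show ?case using Cons by (simp add: fred_Cons)
qed simp

text \<open>The fold applies the rightmost letter first, so a^-i has moved the cursor to -i when b
  acts; hence the sign in \<open>nat (- i)\<close>. Each block returns the cursor to 0 and leaves a
  single \<open>push\<close> behind.\<close>

lemma cursor_emb: "foldr cursor_step (emb w) (0, []) = (0, fred w)"
proof (induction w)
  case (Cons x w)
  have m: "foldr cursor_step (replicate j (a, e)) (i, v) = (if e then i - int j else i + int j, v)" for j e i v
    by (induction j) auto
  show ?case using Cons by (simp add: emb_def emb1_def m fred_Cons del: foldr_replicate)
qed (simp add: emb_def)

lemma fred_emb_trivial_iff: "fred (emb w) = [] \<longleftrightarrow> fred w = []"
proof
  assume "fred (emb w) = []"
  then show "fred w = []"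
    using cursor_fred[of "(0, [])" "emb w"] cursor_emb[of w] by simp
next
  assume "fred w = []"
  then show "fred (emb w) = []" using fred_emb[of w] by (simp add: emb_def)
qed

section \<open>The potential argument\<close>

text \<open>Letters are natural numbers; the residue modulo 4 of a letter is the copy of the alphabet it
  belongs to. In copy k the numbers k and 4 + k are the border letters of the states 1 and 2, the
  letters from 8 on carry the words and the indices. State 0 (as a source) and state 3 (as a target)
  have no border letter. A wound item contains a passage through all four copies.\<close>

datatype 'l item = Item (copy: nat) (src: nat) (lab: 'l) (tgt: nat) (wound: bool)

type_synonym word = "(nat \<times> bool) list"

definition border :: "nat \<Rightarrow> nat \<Rightarrow> bool \<Rightarrow> word" where
  "border k p e = (if p = 1 then [(k, e)] else if p = 2 then [(4 + k, e)] else [])"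

definition item_word :: "word item \<Rightarrow> word" where
  "item_word x = border (copy x) (src x) False @ lab x @ border (copy x) (tgt x) True"

definition list_word :: "word item list \<Rightarrow> word" where
  "list_word xs = concat (map item_word xs)"

lemma list_word_simps [simp]:
  "list_word [] = []" "list_word (x # xs) = item_word x @ list_word xs"
  "list_word (xs @ ys) = list_word xs @ list_word ys"
  by (simp_all add: list_word_def)

lemma border_cancel: "fred (border k p True @ border k p False) = []"
  using fred_cancel[of "(k, True)" "[]"] fred_cancel[of "(4 + k, True)" "[]"] by (simp add: border_def)

text \<open>In the case of 3 facing 0, two visits of one copy have become neighbours; neither side
  has a border letter, so the labels touch directly.\<close>

definition joinable :: "'l item \<Rightarrow> 'm item \<Rightarrow> bool" where
  "joinable x y \<longleftrightarrow> copy x = copy y \<and> (tgt x = src y \<or> tgt x = 3 \<and> src y = 0)"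

definition join :: "word item \<Rightarrow> word item \<Rightarrow> word item" where
  "join x y = Item (copy x) (src x) (lab x @ lab y) (tgt y) (wound x \<or> wound y \<or> tgt x = 3)"

definition trivial :: "word item \<Rightarrow> bool" where
  "trivial x \<longleftrightarrow> fred (lab x) = [] \<and> (src x = tgt x \<or> src x = 0 \<and> tgt x = 3)"

text \<open>The score counts trivial complete items (from 0 to 3) minus nontrivial ones, the number of
  mismatched borders with weight m, and, at an open gap, the least number of items that must have
  disappeared between its two sides if the copies were originally visited in cyclic order.\<close>

definition item_score :: "word item \<Rightarrow> int" where
  "item_score x = (if src x = 0 \<and> tgt x = 3 then (if trivial x then 1 else - 1)
     else if src x \<noteq> 0 \<and> tgt x \<noteq> 3 \<and> wound x then 3 else 0)"

definition gap_score :: "int \<Rightarrow> 'l item \<Rightarrow> 'm item \<Rightarrow> int" where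
  "gap_score m x y = (if tgt x = 3 then (int (copy y) - int (copy x) - 1) mod 4
     else if joinable x y then 1 else m)"

fun score :: "int \<Rightarrow> word item list \<Rightarrow> int" where
  "score m [] = 0"
| "score m [x] = item_score x"
| "score m (x # y # zs) = item_score x + gap_score m x y + score m (y # zs)"

definition copy_letters :: "nat \<Rightarrow> nat set" where
  "copy_letters k = {l. l \<ge> 8 \<and> l mod 4 = k}"

text \<open>The last clause is special to the second component. It makes a closed unwound loop at
  state 1 or 2 nontrivial, and speaks of exponent sums because these have a fixed sign under
  concatenation, whereas nontriviality itself is not preserved.\<close>

definition wf_item :: "int \<Rightarrow> word item \<Rightarrow> bool" where
  "wf_item m x \<longleftrightarrow> copy x < 4 \<and> src x \<in> {0, 1, 2} \<and> tgt x \<in> {1, 2, 3} \<and>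
     fst ` set (lab x) \<subseteq> copy_letters (copy x) \<and>
     (m = - 1 \<and> \<not> wound x \<and> src x \<noteq> 0 \<and> tgt x \<noteq> 3 \<longrightarrow> src x \<le> tgt x \<and>
        (tgt x = 1 \<longrightarrow> esum (lab x) > 0) \<and> (src x = 2 \<longrightarrow> esum (lab x) < 0))"

text \<open>An invariant of the rewriting; it allows \<open>gap_score\<close> to recognise an open
  gap from its left side alone.\<close>

definition compatible :: "'l item \<Rightarrow> 'm item \<Rightarrow> bool" where
  "compatible x y \<longleftrightarrow> (tgt x = 3 \<longleftrightarrow> src y = 0)"

definition wf_list :: "int \<Rightarrow> word item list \<Rightarrow> bool" where
  "wf_list m xs \<longleftrightarrow> xs \<noteq> [] \<and> (\<forall>x \<in> set xs. wf_item m x) \<and>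
     successively compatible xs \<and> src (hd xs) \<noteq> 0 \<and> tgt (last xs) \<noteq> 3"

lemma wf_item_states:
  "wf_item m x \<Longrightarrow> copy x < 4 \<and> src x \<in> {0, 1, 2} \<and> tgt x \<in> {1, 2, 3}"
  unfolding wf_item_def by blast

lemma wf_item_letters: "wf_item m x \<Longrightarrow> fst ` set (lab x) \<subseteq> copy_letters (copy x)"
  unfolding wf_item_def by blast

lemma wf_item_unwound:
  "wf_item (- 1) x \<Longrightarrow> \<not> wound x \<Longrightarrow> src x \<noteq> 0 \<Longrightarrow> tgt x \<noteq> 3 \<Longrightarrow> src x \<le> tgt x \<and>
     (tgt x = 1 \<longrightarrow> esum (lab x) > 0) \<and> (src x = 2 \<longrightarrow> esum (lab x) < 0)"
  unfolding wf_item_def by blast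

lemma score_append:
  "xs \<noteq> [] \<Longrightarrow> ys \<noteq> [] \<Longrightarrow>
   score m (xs @ ys) = score m xs + gap_score m (last xs) (hd ys) + score m ys"
  by (induction m xs rule: score.induct) (cases ys; auto)+

section \<open>Joining two neighbouring items\<close>

lemma fred_item_word_join:
  assumes "joinable x y"
  shows "fred (item_word (join x y)) = fred (item_word x @ item_word y)"
proof -
  have "fred (border (copy x) (tgt x) True @ border (copy y) (src y) False) = []"
    using assms border_cancel[of "copy x" "tgt x"] unfolding joinable_def
    by (elim conjE disjE) (simp_all add: border_def)
  then have "fred ((border (copy x) (src x) False @ lab x) @
      (border (copy x) (tgt x) True @ border (copy y) (src y) False) @
      lab y @ border (copy y) (tgt y) True) =
    fred ((border (copy x) (src x) False @ lab x) @ lab y @ border (copy y) (tgt y) True)"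
    by (rule fred_drop_mid)
  then show ?thesis using assms by (simp add: item_word_def join_def joinable_def)
qed

lemma wf_item_join:
  assumes "joinable x y" "wf_item m x" "wf_item m y"
  shows "wf_item m (join x y)"
proof -
  have j: "copy y = copy x" "tgt x = src y \<or> tgt x = 3 \<and> src y = 0"
    using assms(1) by (simp_all add: joinable_def)
  \<comment> \<open>If the join is unwound and closed, the inner states are equal and both parts are
    closed and unwound. States do not decrease along them, so a loop at 1 or 2 splits into two loops
    at that state, whose exponent sums have the same sign.\<close>
  have u: "src x \<le> tgt y \<and> (tgt y = 1 \<longrightarrow> esum (lab x @ lab y) > 0) \<and>
      (src x = 2 \<longrightarrow> esum (lab x @ lab y) < 0)"
    if "m = - 1" "\<not> wound x" "\<not> wound y" "src x \<noteq> 0" "tgt x \<noteq> 3" "tgt y \<noteq> 3"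
  proof -
    have "tgt x = src y" "src y \<noteq> 0"
      using j that wf_item_states[OF assms(2)] by auto
    then show ?thesis
      using wf_item_unwound[of x] wf_item_unwound[of y] wf_item_states[OF assms(2)] assms that
      by auto
  qed
  show ?thesis
    unfolding wf_item_def join_def item.sel
    using u wf_item_states[OF assms(2)] wf_item_states[OF assms(3)]
      wf_item_letters[OF assms(2)] wf_item_letters[OF assms(3)] j(1)
    by auto
qed

text \<open>The tight cases: items from 0 to p and from p to 3 may form a trivial complete item,
  whose 1 is paid by the gap; two nontrivial complete items of one copy give -1 + 3 - 1 = 1;
  half-open items meeting at an open gap of one copy pay 3 for the new wound item.\<close>

lemma item_score_join:
  assumes "joinable x y" "wf_item m x" "wf_item m y" "m \<in> {1, - 1}" "compatible x y"
  shows "item_score (join x y) \<le> item_score x + gap_score m x y + item_score y"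
proof -
  have "src x \<in> {0, 1, 2}" "tgt x \<in> {1, 2, 3}" "src y \<in> {0, 1, 2}" "tgt y \<in> {1, 2, 3}"
    using wf_item_states assms(2,3) by blast+
  then show ?thesis using assms(1,4,5)
    by (elim insertE emptyE; simp add: item_score_def gap_score_def joinable_def join_def compatible_def)
qed

section \<open>Deleting trivial items\<close>

lemma fred_item_word_trivial:
  assumes "trivial x"
  shows "fred (item_word x) = []"
proof -
  have "fred (item_word x) = fred (border (copy x) (src x) False @ border (copy x) (tgt x) True)"
    unfolding item_word_def using assms by (intro fred_drop_mid) (simp add: trivial_def)
  also have "\<dots> = []"
    using assms fred_cancel[of "(copy x, False)" "[]"] fred_cancel[of "(4 + copy x, False)" "[]"]
    by (auto simp: trivial_def border_def)
  finally show ?thesis .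
qed

text \<open>Such an item has equal states 1 or 2; if unwound, its label would have nonzero exponent
  sum, and free reduction preserves that sum.\<close>

lemma trivial_wound:
  assumes "trivial x" "wf_item (- 1) x" "src x \<noteq> 0"
  shows "wound x"
proof (rule ccontr)
  assume "\<not> wound x"
  then show False
    using assms esum_fred[of "lab x"] wf_item_unwound[of x] wf_item_states[of "- 1" x]
    by (auto simp: trivial_def)
qed

lemma trivial_open_ends: "trivial x \<Longrightarrow> wf_item m x \<Longrightarrow> src x = 0 \<longleftrightarrow> tgt x = 3"
  using wf_item_states[of m x] by (auto simp: trivial_def)

text \<open>Deleting x merges its two gaps. If x is complete, the gap residues are subadditive and
  the score 1 of x supplies the missing unit. If x is closed, the merged gap costs at most 1, which
  is covered by 1 + 0 + 1 for m = 1, and for m = -1 by -1 + 3 - 1 since x is wound.\<close>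

lemma gap_score_triangle:
  assumes "trivial x" "wf_item m x" "wf_item m y" "wf_item m z" "m \<in> {1, - 1}"
    "compatible y x" "compatible x z"
  shows "gap_score m y z \<le> gap_score m y x + item_score x + gap_score m x z"
proof (cases "src x = 0")
  case True
  have "(t - s - 1) mod 4 \<le> (k - s - 1) mod 4 + 1 + (t - k - 1) mod 4" for s k t :: int
    by presburger
  moreover have "tgt x \<noteq> 0" using wf_item_states[OF assms(2)] by auto
  ultimately show ?thesis using True assms(1,3-) unfolding compatible_def
    by (auto simp: gap_score_def item_score_def trivial_def)
next
  case False
  moreover have "src x \<noteq> 3" using wf_item_states[OF assms(2)] by auto
  ultimately show ?thesis using assms trivial_wound[of x] unfolding compatible_def
    by (auto simp: gap_score_def item_score_def trivial_def)
qed

text \<open>For deletion at an end of the list, where one gap disappears together with x: that gap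
  is worth at least m, and for m = -1 the wound item x is worth 3.\<close>

lemma end_score:
  assumes "trivial x" "wf_item m x" "m \<in> {1, - 1}" "src x \<noteq> 0"
  shows "tgt y \<noteq> 3 \<Longrightarrow> 0 \<le> gap_score m y x + item_score x"
    and "0 \<le> item_score x + gap_score m x y"
proof -
  have "src x \<noteq> 3" using wf_item_states[OF assms(2)] by auto
  then show "tgt y \<noteq> 3 \<Longrightarrow> 0 \<le> gap_score m y x + item_score x"
    and "0 \<le> item_score x + gap_score m x y"
    using assms trivial_wound[of x]
    by (auto simp: gap_score_def item_score_def trivial_def)
qed

section \<open>Irreducible lists spell nontrivial words\<close>

lemma cancel_free_item_word:
  assumes "wf_item m x" "\<not> trivial x" "fred (lab x) = lab x"
  shows "item_word x \<noteq> [] \<and> cancel_free (item_word x)"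
proof -
  have 1: "cancel_free (lab x)" using assms(3) cancel_free_fred[of "lab x"] by metis
  \<comment> \<open>Border letters lie below 8, so they cannot cancel against the label. With an
    empty label, nontriviality means that exactly one border letter is present or that the two are
    different.\<close>
  have 2: "lab x \<noteq> [] \<Longrightarrow> fst (hd (lab x)) \<ge> 8 \<and> fst (last (lab x)) \<ge> 8"
    using wf_item_letters[OF assms(1)] by (auto simp: copy_letters_def image_subset_iff)
  have "copy x < 4" "src x \<in> {0, 1, 2}" "tgt x \<in> {1, 2, 3}"
    using wf_item_states[OF assms(1)] by auto
  moreover have "lab x = [] \<Longrightarrow> src x \<noteq> tgt x \<and> (src x = 0 \<longrightarrow> tgt x \<noteq> 3)"
    using assms(2) by (auto simp: trivial_def)
  ultimately show ?thesis using 1 2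
    by (cases "lab x = []")
      (auto simp: item_word_def border_def successively_append_iff)
qed

lemma item_word_residue:
  assumes "wf_item m x" "l \<in> set (item_word x)"
  shows "fst l mod 4 = copy x"
  using assms(2) wf_item_states[OF assms(1)] wf_item_letters[OF assms(1)]
  by (auto simp: item_word_def border_def copy_letters_def split: if_splits)

text \<open>Letters of different copies differ modulo 4. Within one copy, compatibility leaves only
  the states 1 and 2 at the contact, and distinct states have distinct border letters.\<close>

lemma not_joinable_no_cancel:
  assumes "wf_item m x" "wf_item m y" "item_word x \<noteq> []" "item_word y \<noteq> []"
    "\<not> joinable x y" "compatible x y"
  shows "hd (item_word y) \<noteq> (fst (last (item_word x)), \<not> snd (last (item_word x)))"
proof (cases "copy x = copy y")
  case False
  then show ?thesis
    using item_word_residue[OF assms(1) last_in_set[OF assms(3)]]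
      item_word_residue[OF assms(2) hd_in_set[OF assms(4)]] by auto
next
  case True
  then have "tgt x \<in> {1, 2}" "src y \<in> {1, 2}" "tgt x \<noteq> src y"
    using wf_item_states[OF assms(1)] wf_item_states[OF assms(2)] assms(5,6)
    by (auto simp: joinable_def compatible_def)
  then show ?thesis using True by (auto simp: item_word_def border_def)
qed

lemma irreducible_nontrivial:
  assumes "wf_list m xs" "\<forall>x \<in> set xs. \<not> trivial x" "successively (\<lambda>x y. \<not> joinable x y) xs"
  shows "fred (list_word xs) \<noteq> []"
proof -
  \<comment> \<open>Only labels are reduced. States and flags stay, and reduction neither adds
    letters nor changes exponent sums, so well-formedness survives.\<close>
  define red_item where "red_item x = Item (copy x) (src x) (fred (lab x)) (tgt x) (wound x)"
    for x :: "word item"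
  have wf: "wf_item m (red_item x)" if "x \<in> set xs" for x
  proof -
    have "wf_item m x" using that assms(1) by (simp add: wf_list_def)
    then show ?thesis
      using image_mono[OF set_fred[of "lab x"], of fst]
      unfolding wf_item_def red_item_def item.sel esum_fred by blast
  qed
  have cf: "item_word (red_item x) \<noteq> [] \<and> cancel_free (item_word (red_item x))" if "x \<in> set xs" for x
    using that assms(2) by (intro cancel_free_item_word[OF wf]) (auto simp: red_item_def trivial_def)
  have "successively (\<lambda>x y. \<not> joinable x y \<and> compatible x y) xs"
    using assms(1,3) by (auto simp: wf_list_def successively_conv_nth)
  then have "successively (\<lambda>x y. hd (item_word (red_item y)) \<noteq>
      (fst (last (item_word (red_item x))), \<not> snd (last (item_word (red_item x))))) xs"
  proof (rule successively_mono)
    fix x y assume "x \<in> set xs" "y \<in> set xs" "\<not> joinable x y \<and> compatible x y"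
    then show "hd (item_word (red_item y)) \<noteq>
        (fst (last (item_word (red_item x))), \<not> snd (last (item_word (red_item x))))"
      using cf wf by (intro not_joinable_no_cancel[of m]) (auto simp: red_item_def joinable_def compatible_def)
  qed
  then have "cancel_free (concat (map (\<lambda>x. item_word (red_item x)) xs))"
    using cf by (intro successively_concat) (auto simp: successively_map)
  then have "fred (concat (map (\<lambda>x. item_word (red_item x)) xs)) =
      concat (map (\<lambda>x. item_word (red_item x)) xs)"
    by (rule fred_id)
  moreover have "concat (map (\<lambda>x. item_word (red_item x)) xs) \<noteq> []"
    using cf assms(1) by (cases xs) (auto simp: wf_list_def)
  moreover have "fred (item_word (red_item x)) = fred (item_word x)" for x
    by (auto simp: item_word_def red_item_def intro!: fred_append_cong)
  then have "fred (concat (map (\<lambda>x. item_word (red_item x)) xs)) = fred (list_word xs)"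
    unfolding list_word_def by (intro fred_concat_cong)
  ultimately show ?thesis by simp
qed

section \<open>The descent on item lists\<close>

lemma not_successively_split:
  "\<not> successively R xs \<Longrightarrow> \<exists>us x y vs. xs = us @ x # y # vs \<and> \<not> R x y"
proof (induction xs rule: induct_list012)
  case (3 x y zs)
  show ?case
  proof (cases "R x y")
    case True
    then obtain us x' y' vs where "y # zs = us @ x' # y' # vs" "\<not> R x' y'"
      using 3 by auto
    then have "x # y # zs = (x # us) @ x' # y' # vs" "\<not> R x' y'" by simp_all
    then show ?thesis by blast
  qed (use append_Nil in blast)
qed auto

lemma successively_join:
  assumes "successively R (us @ x # y # vs)" "\<And>z. R z x \<Longrightarrow> R z w" "\<And>z. R y z \<Longrightarrow> R w z"
  shows "successively R (us @ w # vs)"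
  using assms by (auto simp: successively_append_iff successively_Cons)

lemma wf_list_join:
  assumes "wf_list m (us @ x # y # vs)" "joinable x y"
  shows "wf_list m (us @ join x y # vs)"
proof -
  have "wf_item m (join x y)" using assms by (intro wf_item_join) (auto simp: wf_list_def)
  moreover have "successively compatible (us @ join x y # vs)"
  proof (rule successively_join)
    show "successively compatible (us @ x # y # vs)"
      using assms(1) unfolding wf_list_def by blast
  qed (simp_all add: join_def compatible_def)
  moreover have "src (hd (us @ join x y # vs)) \<noteq> 0"
    using assms(1) by (cases us) (simp_all add: wf_list_def join_def)
  moreover have "tgt (last (us @ join x y # vs)) \<noteq> 3"
    using assms(1) by (cases "vs = []") (simp_all add: wf_list_def join_def)
  ultimately show ?thesis using assms(1) by (simp add: wf_list_def)
qed

lemma score_join: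
  assumes "wf_list m (us @ x # y # vs)" "joinable x y" "m \<in> {1, - 1}"
  shows "score m (us @ join x y # vs) \<le> score m (us @ x # y # vs)"
proof -
  have le: "item_score (join x y) \<le> item_score x + gap_score m x y + item_score y"
    using assms by (intro item_score_join)
      (auto simp: wf_list_def successively_append_iff)
  \<comment> \<open>The outer gaps see only the common copy and the outer states, which joining
    keeps.\<close>
  have g1: "gap_score m (join x y) z = gap_score m y z" for z :: "word item"
    using assms(2) by (auto simp: gap_score_def join_def joinable_def)
  have g2: "gap_score m z (join x y) = gap_score m z x" for z :: "word item"
    by (auto simp: gap_score_def join_def joinable_def)
  show ?thesis using le
    by (cases "us = []"; cases vs) (simp_all add: score_append g1 g2)
qed

lemma wf_list_remove:
  assumes "wf_list m (us @ x # vs)" "trivial x" "us @ vs \<noteq> []"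
  shows "wf_list m (us @ vs)"
proof -
  have x: "src x = 0 \<longleftrightarrow> tgt x = 3"
    using assms(1,2) trivial_open_ends[of x m] by (simp add: wf_list_def)
  have succ: "successively compatible us" "successively compatible vs"
      "us \<noteq> [] \<Longrightarrow> compatible (last us) x" "vs \<noteq> [] \<Longrightarrow> compatible x (hd vs)"
    using assms(1) by (auto simp: wf_list_def successively_append_iff successively_Cons)
  then have "successively compatible (us @ vs)"
    using x by (auto simp: successively_append_iff compatible_def)
  moreover have "src (hd (us @ vs)) \<noteq> 0"
    using succ(4) x assms(1,3) by (cases us) (auto simp: wf_list_def compatible_def)
  moreover have "tgt (last (us @ vs)) \<noteq> 3"
    using succ(3) x assms(1,3) by (cases "vs = []") (auto simp: wf_list_def compatible_def)
  ultimately show ?thesis using assms(1,3) by (simp add: wf_list_def)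
qed

lemma score_remove:
  assumes "wf_list m (us @ x # vs)" "trivial x" "m \<in> {1, - 1}" "us @ vs \<noteq> []"
  shows "score m (us @ vs) \<le> score m (us @ x # vs)"
proof -
  have wf: "wf_item m z" if "z \<in> set (us @ x # vs)" for z
    using that assms(1) by (auto simp: wf_list_def)
  show ?thesis
  proof (cases "us = []")
    case True
    then obtain v vs' where "vs = v # vs'" using assms(4) by (cases vs) auto
    then show ?thesis
      using True assms end_score(2)[OF assms(2) wf assms(3), of v]
      by (auto simp: wf_list_def)
  next
    case us: False
    show ?thesis
    proof (cases "vs = []")
      case True
      have "src x \<noteq> 0 \<and> tgt (last us) \<noteq> 3"
        using assms(1,2) us True trivial_open_ends[OF assms(2) wf[of x]]
        by (auto simp: wf_list_def compatible_def successively_append_iff)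
      then show ?thesis
        using us True end_score(1)[OF assms(2) wf assms(3), of "last us"]
        by (auto simp: score_append)
    next
      case False
      have "gap_score m (last us) (hd vs) \<le>
          gap_score m (last us) x + item_score x + gap_score m x (hd vs)"
        using assms us False wf
        by (intro gap_score_triangle)
          (auto simp: wf_list_def successively_append_iff successively_Cons)
      then show ?thesis using us False
        by (cases vs) (auto simp: score_append)
    qed
  qed
qed

text \<open>Either two neighbours can be joined, or a trivial item can be removed, or the list spells a
  nonempty reduced word.\<close>

lemma score_bound:
  assumes "wf_list m xs" "fred (list_word xs) = []" "m \<in> {1, - 1}"
  shows "(if m = 1 then 0 else 3) \<le> score m xs"
  using assms
proof (induction xs rule: length_induct)
  case (1 xs)
  show ?case
  proof (cases "successively (\<lambda>x y. \<not> joinable x y) xs")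
    case False
    then obtain us x y vs where xs: "xs = us @ x # y # vs" and j: "joinable x y"
      using not_successively_split by blast
    have "fred (item_word (join x y)) = fred (item_word x @ item_word y)"
      using j by (rule fred_item_word_join)
    then have "fred (list_word (us @ join x y # vs)) = fred (list_word xs)"
      using fred_append_cong[OF refl fred_append_cong[OF _ refl],
          of "item_word (join x y)" "item_word x @ item_word y" "list_word us" "list_word vs"]
      by (simp add: xs)
    then have "(if m = 1 then 0 else 3) \<le> score m (us @ join x y # vs)"
      using 1 xs wf_list_join[OF _ j] by (intro 1(1)[rule_format]) auto
    then show ?thesis using score_join[of m us x y vs] 1 xs j by simp
  next
    case True
    then obtain x where x: "x \<in> set xs" "trivial x"
      using irreducible_nontrivial 1 by blast
    then obtain us vs where xs: "xs = us @ x # vs" by (meson split_list)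
    show ?thesis
    proof (cases "us @ vs = []")
      \<comment> \<open>A single item is left. It is closed by \<open>wf_list\<close>, and for m =
        -1 it is wound, which yields the 3.\<close>
      case True
      then show ?thesis using xs x 1 trivial_wound[of x]
        by (auto simp: wf_list_def item_score_def trivial_def)
    next
      case False
      have "fred (item_word x) = []"
        using x(2) by (rule fred_item_word_trivial)
      then have "fred (list_word (us @ vs)) = fred (list_word xs)"
        unfolding xs by (simp add: fred_drop_mid)
      then have "(if m = 1 then 0 else 3) \<le> score m (us @ vs)"
        using 1 xs wf_list_remove[of m us x vs] x False by (intro 1(1)[rule_format]) auto
      then show ?thesis using score_remove[of m us x vs] 1 xs x False by simp
    qed
  qed
qed

section \<open>The reduction\<close>

text \<open>The summand 2 keeps the letters at 8 or above, clear of the border letters, and the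
  residue modulo 4 is the copy. \<open>index_letter\<close> may reuse these numbers because words
  and indices occur in different components.\<close>

definition spell :: "nat \<Rightarrow> gen list \<Rightarrow> word" where
  "spell k w = pos (map (\<lambda>g. 4 * (2 + enc_gen g) + k) w)"

definition index_letter :: "nat \<Rightarrow> nat \<Rightarrow> nat" where
  "index_letter k i = 4 * (2 + i) + k"

datatype tile = Up nat nat | Down nat nat | Turn nat | Next nat

text \<open>The first component of a label spells words of the PCP instance, the second one records the
  indices used.\<close>

definition start_lab :: "pcp_instance \<Rightarrow> nat \<Rightarrow> word \<times> word" where
  "start_lab P k = (spell k (fst (P ! 0)), [])"

definition up_lab :: "pcp_instance \<Rightarrow> nat \<Rightarrow> nat \<Rightarrow> word \<times> word" where
  "up_lab P k i = (spell k (fst (P ! i)), pos [index_letter k i])"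

definition turn_lab :: "pcp_instance \<Rightarrow> nat \<Rightarrow> word \<times> word" where
  "turn_lab P k = (spell k (fst (P ! (length P - 1))) @ winv (spell k (snd (P ! (length P - 1)))), [])"

definition down_lab :: "pcp_instance \<Rightarrow> nat \<Rightarrow> nat \<Rightarrow> word \<times> word" where
  "down_lab P k i = (winv (spell k (snd (P ! i))), winv (pos [index_letter k i]))"

definition exit_lab :: "pcp_instance \<Rightarrow> nat \<Rightarrow> word \<times> word" where
  "exit_lab P k = (winv (spell k (snd (P ! 0))), [])"

text \<open>A visit runs through the states 0, 1, 2, 3. \<open>Next k\<close> fuses the exit from
  copy k with the entry into the following copy, so no visit can begin or end on its own; this
  enforces the cyclic order.\<close>

fun tile_items :: "pcp_instance \<Rightarrow> tile \<Rightarrow> (word \<times> word) item list" where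
  "tile_items P (Up k i) = [Item k 1 (up_lab P k i) 1 False]"
| "tile_items P (Down k i) = [Item k 2 (down_lab P k i) 2 False]"
| "tile_items P (Turn k) = [Item k 1 (turn_lab P k) 2 False]"
| "tile_items P (Next k) =
    [Item k 2 (exit_lab P k) 3 False, Item (Suc k mod 4) 0 (start_lab P (Suc k mod 4)) 1 False]"

definition tile_word :: "(word \<times> word \<Rightarrow> word) \<Rightarrow> pcp_instance \<Rightarrow> tile \<Rightarrow> word" where
  "tile_word c P t = list_word (map (map_item c) (tile_items P t))"

definition tiles :: "nat \<Rightarrow> tile list" where
  "tiles n = concat (map (\<lambda>k. [Turn k, Next k] @ map (Up k) [1..<n - 1] @ map (Down k) [1..<n - 1]) [0..<4])"

definition icp_of :: "pcp_instance \<Rightarrow> icp_instance" where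
  "icp_of P = map (\<lambda>t. (red (emb (tile_word fst P t)), red (emb (tile_word snd P t)))) (tiles (length P))"

text \<open>Each of the 4 copies has one \<open>Turn\<close>, one \<open>Next\<close> and two tiles
  for each of the n - 2 intermediate indices.\<close>

lemma length_tiles: "n \<ge> 3 \<Longrightarrow> length (tiles n) = 8 * (n - 1)"
  by (simp add: tiles_def length_concat upt_conv_Cons)

lemma set_tiles:
  "set (tiles n) = (\<Union>k<4. {Turn k, Next k} \<union> Up k ` {1..<n - 1} \<union> Down k ` {1..<n - 1})"
  by (auto simp: tiles_def)

lemma icp_of_in_instances: "length P = n \<Longrightarrow> n \<ge> 3 \<Longrightarrow> icp_of P \<in> icp_instances (8 * (n - 1))"
  by (auto simp: icp_of_def icp_instances_def length_tiles reduced_red)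

lemma red_concat_emb:
  "red (concat (map (\<lambda>t. red (emb (f t))) ts)) = [] \<longleftrightarrow> fred (concat (map f ts)) = []"
proof -
  have "red (concat (map (\<lambda>t. red (emb (f t))) ts)) = fred (concat (map (\<lambda>t. emb (f t)) ts))"
    unfolding red_eq_fred by (rule fred_concat_cong) simp
  also have "\<dots> = fred (emb (concat (map f ts)))"
    by (simp add: emb_concat comp_def)
  finally show ?thesis by (simp add: fred_emb_trivial_iff)
qed

lemma ICP_icp_of:
  "ICP (icp_of P) \<longleftrightarrow> (\<exists>ts. ts \<noteq> [] \<and> set ts \<subseteq> set (tiles (length P)) \<and>
     (\<forall>c \<in> {fst, snd}. fred (concat (map (tile_word c P) ts)) = []))"
  (is "?L \<longleftrightarrow> ?R")
proof
  let ?T = "tiles (length P)"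
  have sel: "map (\<lambda>l. fst (icp_of P ! l)) ls = map (\<lambda>t. red (emb (tile_word fst P t))) (map ((!) ?T) ls)"
    "map (\<lambda>l. snd (icp_of P ! l)) ls = map (\<lambda>t. red (emb (tile_word snd P t))) (map ((!) ?T) ls)"
    if "\<forall>l \<in> set ls. l < length ?T" for ls
    using that by (auto simp: icp_of_def)
  {
    assume ?L
    then obtain ls where "ls \<noteq> []" and lt: "\<forall>l \<in> set ls. l < length ?T"
      and "red (concat (map (\<lambda>l. fst (icp_of P ! l)) ls)) = []"
      and "red (concat (map (\<lambda>l. snd (icp_of P ! l)) ls)) = []"
      by (auto simp: ICP_def icp_of_def)
    then have "map ((!) ?T) ls \<noteq> [] \<and> set (map ((!) ?T) ls) \<subseteq> set ?T \<and>
        (\<forall>c \<in> {fst, snd}. fred (concat (map (tile_word c P) (map ((!) ?T) ls))) = [])"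
      unfolding sel[OF lt] red_concat_emb by auto
    then show ?R by blast
  next
    assume ?R
    then obtain ts where ts: "ts \<noteq> []" "set ts \<subseteq> set ?T"
      "\<forall>c \<in> {fst, snd}. fred (concat (map (tile_word c P) ts)) = []"
      by blast
    from ts(2) have "\<forall>t \<in> set ts. \<exists>l < length ?T. ?T ! l = t"
      by (metis in_set_conv_nth subsetD)
    then obtain f where f: "\<forall>t \<in> set ts. f t < length ?T \<and> ?T ! f t = t"
      by metis
    then have lt: "\<forall>l \<in> set (map f ts). l < length ?T" by auto
    have "map ((!) ?T) (map f ts) = ts" using f by (simp add: map_idI)
    then have "red (concat (map (\<lambda>l. fst (icp_of P ! l)) (map f ts))) = []"
      "red (concat (map (\<lambda>l. snd (icp_of P ! l)) (map f ts))) = []"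
      unfolding sel[OF lt] red_concat_emb using ts(3) by simp_all
    then show ?L unfolding ICP_def
      using ts(1) lt by (intro exI[of _ "map f ts"]) (simp add: icp_of_def)
  }
qed

subsection \<open>Solutions of the PCP yield identities\<close>

lemma border_glue:
  "fred ((border k p False @ v @ border k q True) @ border k q False @ w) =
   fred (border k p False @ v @ w)"
  using fred_drop_mid[OF border_cancel[of k q], of "border k p False @ v" w] by simp

lemma map_Up_glue:
  "fred (concat (map (tile_word c P) (map (Up k) ls)) @ border k 1 False @ w) =
   fred (border k 1 False @ concat (map (\<lambda>i. c (up_lab P k i)) ls) @ w)"
proof (induction ls)
  case (Cons i ls)
  have "fred (concat (map (tile_word c P) (map (Up k) (i # ls))) @ border k 1 False @ w) =
    fred (tile_word c P (Up k i) @ border k 1 False @ concat (map (\<lambda>i. c (up_lab P k i)) ls) @ w)"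
    using fred_append_cong[OF refl Cons] by simp
  also have "tile_word c P (Up k i) = border k 1 False @ c (up_lab P k i) @ border k 1 True"
    by (simp add: tile_word_def item_word_def)
  also note border_glue
  finally show ?case by simp
qed simp

lemma map_Down_glue:
  "fred (concat (map (tile_word c P) (map (Down k) ls)) @ border k 2 False @ w) =
   fred (border k 2 False @ concat (map (\<lambda>i. c (down_lab P k i)) ls) @ w)"
proof (induction ls)
  case (Cons i ls)
  have "fred (concat (map (tile_word c P) (map (Down k) (i # ls))) @ border k 2 False @ w) =
    fred (tile_word c P (Down k i) @ border k 2 False @ concat (map (\<lambda>i. c (down_lab P k i)) ls) @ w)"
    using fred_append_cong[OF refl Cons] by simp
  also have "tile_word c P (Down k i) = border k 2 False @ c (down_lab P k i) @ border k 2 True"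
    by (simp add: tile_word_def item_word_def)
  also note border_glue
  finally show ?case by simp
qed simp

lemma winv_Cons: "winv (x # w) = winv w @ [(fst x, \<not> snd x)]"
  by (simp add: winv_def)

definition round :: "nat list \<Rightarrow> nat \<Rightarrow> tile list" where
  "round ls k = map (Up k) ls @ [Turn k] @ map (Down k) (rev ls) @ [Next k]"

text \<open>The assumption is that a complete visit is trivial, start label included. That start
  label is spelled by the \<open>Next\<close> tile of the previous round, so a round is
  \<open>h k\<close> times the inverse of the following \<open>h\<close>, a form that
  telescopes.\<close>

lemma fred_round:
  fixes c :: "word \<times> word \<Rightarrow> word" and P :: pcp_instance
  defines "h \<equiv> \<lambda>k. border k 1 False @ winv (c (start_lab P k))"
  assumes "fred (c (start_lab P k) @ concat (map (\<lambda>i. c (up_lab P k i)) ls) @ c (turn_lab P k) @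
      concat (map (\<lambda>i. c (down_lab P k i)) (rev ls)) @ c (exit_lab P k)) = []"
    (is "fred (_ @ ?X) = []")
  shows "fred (concat (map (tile_word c P) (round ls k))) = fred (h k @ winv (h (Suc k mod 4)))"
proof -
  let ?u = "concat (map (\<lambda>i. c (up_lab P k i)) ls)"
  let ?d = "concat (map (\<lambda>i. c (down_lab P k i)) (rev ls))"
  let ?k = "Suc k mod 4"
  have next_word: "tile_word c P (Next k) = border k 2 False @ c (exit_lab P k) @ winv (h ?k)"
    by (simp add: tile_word_def item_word_def h_def winv_append border_def winv_Cons)
  have turn_word: "tile_word c P (Turn k) = border k 1 False @ c (turn_lab P k) @ border k 2 True"
    by (simp add: tile_word_def item_word_def)
  have "fred (concat (map (tile_word c P) (round ls k))) =
    fred (concat (map (tile_word c P) (map (Up k) ls)) @ tile_word c P (Turn k) @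
      concat (map (tile_word c P) (map (Down k) (rev ls))) @
      border k 2 False @ c (exit_lab P k) @ winv (h ?k))"
    by (simp add: round_def next_word)
  also have "\<dots> = fred (concat (map (tile_word c P) (map (Up k) ls)) @ tile_word c P (Turn k) @
      border k 2 False @ ?d @ c (exit_lab P k) @ winv (h ?k))"
    by (intro fred_append_cong refl map_Down_glue)
  also have "\<dots> = fred (concat (map (tile_word c P) (map (Up k) ls)) @
      border k 1 False @ c (turn_lab P k) @ ?d @ c (exit_lab P k) @ winv (h ?k))"
    unfolding turn_word by (intro fred_append_cong refl border_glue)
  also have "\<dots> = fred (border k 1 False @ ?u @ c (turn_lab P k) @ ?d @ c (exit_lab P k) @ winv (h ?k))"
    by (rule map_Up_glue)
  also have "\<dots> = fred (border k 1 False @ ?X @ winv (h ?k))"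
    by simp
  also have "\<dots> = fred (h k @ winv (h ?k))"
  proof -
    have "fred ?X = fred (winv (c (start_lab P k)) @ c (start_lab P k) @ ?X)"
      using fred_drop_mid[OF fred_winv_left[of "c (start_lab P k)"], of "[]" ?X] by simp
    also have "\<dots> = fred (winv (c (start_lab P k)))"
      using fred_drop_mid[OF assms(2), of "winv (c (start_lab P k))" "[]"] by simp
    finally have "fred ?X = fred (winv (c (start_lab P k)))" .
    from fred_append_cong[OF refl fred_append_cong[OF this refl], of "border k 1 False" "winv (h ?k)"]
    show ?thesis by (simp add: h_def)
  qed
  finally show ?thesis .
qed

lemma fred_telescope: "fred ((u @ winv v) @ v @ w) = fred (u @ w)"
  using fred_drop_mid[OF fred_winv_left[of v], of u w] by simp

lemma spell_append: "spell k (u @ v) = spell k u @ spell k v"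
  by (simp add: spell_def pos_append)

lemma spell_concat: "spell k (concat ws) = concat (map (spell k) ws)"
  by (induction ws) (auto simp: spell_append, simp add: spell_def pos_def)

lemma winv_Nil [simp]: "winv [] = []"
  by (simp add: winv_def)

lemma winv_concat_rev: "concat (map (\<lambda>i. winv (f i)) (rev ls)) = winv (concat (map f ls))"
  by (induction ls) (auto simp: winv_append)

lemma RPCP_imp_identity:
  assumes "RPCP P" "length P \<ge> 3"
  shows "ICP (icp_of P)"
proof -
  obtain ls where ls: "\<forall>l \<in> set ls. 1 \<le> l \<and> l \<le> length P - 2"
    and eq: "fst (P ! 0) @ concat (map (\<lambda>l. fst (P ! l)) ls) @ fst (P ! (length P - 1)) =
      snd (P ! 0) @ concat (map (\<lambda>l. snd (P ! l)) ls) @ snd (P ! (length P - 1))"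
    using assms(1) by (auto simp: RPCP_def)
  \<comment> \<open>The same solution is spelled once in each copy; \<open>Next 3\<close> leads back
    into copy 0 and closes the telescope.\<close>
  let ?ts = "concat (map (round ls) [0..<4])"
  have "set ?ts \<subseteq> set (tiles (length P))"
    using ls assms(2) by (fastforce simp: round_def set_tiles)
  moreover have "fred (concat (map (tile_word c P) ?ts)) = []" if c: "c \<in> {fst, snd}" for c
  proof -
    define h where "h k = border k 1 False @ winv (c (start_lab P k))" for k
    have rd: "fred (concat (map (tile_word c P) (round ls k))) = fred (h k @ winv (h (Suc k mod 4)))" for k
      unfolding h_def
    proof (rule fred_round)
      show "fred (c (start_lab P k) @ concat (map (\<lambda>i. c (up_lab P k i)) ls) @ c (turn_lab P k) @
          concat (map (\<lambda>i. c (down_lab P k i)) (rev ls)) @ c (exit_lab P k)) = []"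
      proof (cases "c = fst")
        case True
        let ?U = "fst (P ! 0) @ concat (map (\<lambda>l. fst (P ! l)) ls) @ fst (P ! (length P - 1))"
        let ?V = "snd (P ! 0) @ concat (map (\<lambda>l. snd (P ! l)) ls) @ snd (P ! (length P - 1))"
        have "fred (spell k ?U @ winv (spell k ?V)) = []"
          unfolding eq by (rule fred_winv_right)
        then show ?thesis
          using True by (simp add: start_lab_def up_lab_def turn_lab_def down_lab_def exit_lab_def
              winv_concat_rev spell_append spell_concat winv_append comp_def)
      next
        case False
        then have "c = snd" using c by simp
        then show ?thesis
          using fred_winv_right[of "concat (map (\<lambda>i. pos [index_letter k i]) ls)"]
          by (simp add: start_lab_def up_lab_def turn_lab_def down_lab_def exit_lab_def winv_concat_rev)
      qed
    qed
    have "fred (concat (map (tile_word c P) ?ts)) =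
      fred ((h 0 @ winv (h 1)) @ (h 1 @ winv (h 2)) @ (h 2 @ winv (h 3)) @ (h 3 @ winv (h 0)))"
    proof -
      have "concat (map (tile_word c P) ?ts) = concat (map (tile_word c P) (round ls 0)) @
          concat (map (tile_word c P) (round ls 1)) @ concat (map (tile_word c P) (round ls 2)) @
          concat (map (tile_word c P) (round ls 3))"
        by (simp add: upt_conv_Cons numeral_eq_Suc)
      moreover have "Suc 0 mod 4 = 1" "Suc 1 mod 4 = 2" "Suc 2 mod 4 = 3" "Suc 3 mod 4 = 0"
        by simp_all
      ultimately show ?thesis
        using rd[of 0] rd[of 1] rd[of 2] rd[of 3] by (simp only:) (intro fred_append_cong)
    qed
    also have "\<dots> = []"
      using fred_telescope[of "h 0" "h 1" "winv (h 2) @ h 2 @ winv (h 3) @ h 3 @ winv (h 0)"]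
        fred_telescope[of "h 0" "h 2" "winv (h 3) @ h 3 @ winv (h 0)"]
        fred_telescope[of "h 0" "h 3" "winv (h 0)"] fred_winv_right[of "h 0"]
      by simp
    finally show ?thesis .
  qed
  moreover have "?ts \<noteq> []" by (simp add: upt_conv_Cons round_def)
  ultimately show ?thesis unfolding ICP_icp_of by blast
qed

subsection \<open>Identities yield solutions of the PCP\<close>

definition linked :: "'l item \<Rightarrow> 'm item \<Rightarrow> bool" where
  "linked x y \<longleftrightarrow> compatible x y \<and> (tgt x = 3 \<longrightarrow> copy y = Suc (copy x) mod 4)"

definition matched :: "'l item \<Rightarrow> 'm item \<Rightarrow> bool" where
  "matched x y \<longleftrightarrow> copy x = copy y \<and> tgt x = src y"

text \<open>Fitting neighbours are merged in both components simultaneously. Both scores then refer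
  to one list of items, in which every closed gap is a mismatch worth exactly m.\<close>

fun attach :: "(word \<times> word) item \<Rightarrow> (word \<times> word) item list \<Rightarrow> (word \<times> word) item list" where
  "attach x [] = [x]"
| "attach x (y # ys) = (if matched x y then
      Item (copy x) (src x) (fst (lab x) @ fst (lab y), snd (lab x) @ snd (lab y)) (tgt y) False # ys
    else x # y # ys)"

definition index_word :: "nat \<Rightarrow> nat list \<Rightarrow> word" where
  "index_word k I = pos (map (index_letter k) I)"

text \<open>The label of a path within one copy from state p to state q: I lists the indices used in state 1
  and J, in reverse order, those used in state 2.\<close>

definition path_lab :: "pcp_instance \<Rightarrow> nat \<Rightarrow> nat \<Rightarrow> nat \<Rightarrow> nat list \<Rightarrow> nat list \<Rightarrow> word \<times> word" where
  "path_lab P k p q I J =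
    ((if p = 0 then fst (start_lab P k) else []) @
      spell k (concat (map (\<lambda>i. fst (P ! i)) I)) @
      (if p \<le> 1 \<and> q \<ge> 2 then fst (turn_lab P k) else []) @
      winv (spell k (concat (map (\<lambda>i. snd (P ! i)) J))) @
      (if q = 3 then fst (exit_lab P k) else []),
     index_word k I @ winv (index_word k J))"

text \<open>The last clause rules out empty loops, so that a loop at 1 or 2 has the nonzero exponent
  sum demanded by \<open>wf_item\<close> for m = -1.\<close>

definition is_path :: "pcp_instance \<Rightarrow> (word \<times> word) item \<Rightarrow> nat list \<Rightarrow> nat list \<Rightarrow> bool" where
  "is_path P x I J \<longleftrightarrow> lab x = path_lab P (copy x) (src x) (tgt x) I J \<and>
    set I \<union> set J \<subseteq> {1..<length P - 1} \<and> (src x = 2 \<longrightarrow> I = []) \<and> (tgt x = 1 \<longrightarrow> J = []) \<and>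
    (src x = tgt x \<longrightarrow> I @ J \<noteq> [])"

definition valid :: "pcp_instance \<Rightarrow> (word \<times> word) item \<Rightarrow> bool" where
  "valid P x \<longleftrightarrow> copy x < 4 \<and> src x \<in> {0, 1, 2} \<and> tgt x \<in> {1, 2, 3} \<and> src x \<le> tgt x \<and> \<not> wound x \<and>
    (\<exists>I J. is_path P x I J)"

section \<open>Items as paths within one copy\<close>

lemma spell_Nil [simp]: "spell k [] = []"
  by (simp add: spell_def pos_def)

lemma index_word_Nil [simp]: "index_word k [] = []"
  by (simp add: index_word_def pos_def)

lemma index_word_append: "index_word k (I @ J) = index_word k I @ index_word k J"
  by (simp add: index_word_def pos_append)

lemma valid_tile_items:
  assumes "t \<in> set (tiles (length P))" "x \<in> set (tile_items P t)"
  shows "valid P x"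
proof -
  obtain k where k: "k < 4" and
    t: "t = Turn k \<or> t = Next k \<or> (\<exists>i \<in> {1..<length P - 1}. t = Up k i \<or> t = Down k i)"
    using assms(1) by (auto simp: set_tiles)
  have validI: "is_path P x I J \<Longrightarrow> copy x < 4 \<and> src x \<in> {0, 1, 2} \<and> tgt x \<in> {1, 2, 3} \<and>
      src x \<le> tgt x \<and> \<not> wound x \<Longrightarrow> valid P x" for I J
    unfolding valid_def by blast
  from t show ?thesis
  proof (elim disjE bexE)
    fix i assume "i \<in> {1..<length P - 1}" "t = Up k i"
    then show ?thesis using assms(2) k
      by (intro validI[of "[i]" "[]"])
        (auto simp: is_path_def path_lab_def up_lab_def index_word_def pos_def winv_def)
  next
    fix i assume "i \<in> {1..<length P - 1}" "t = Down k i"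
    then show ?thesis using assms(2) k
      by (intro validI[of "[]" "[i]"])
        (auto simp: is_path_def path_lab_def down_lab_def index_word_def pos_def winv_def)
  next
    assume "t = Turn k"
    then show ?thesis using assms(2) k
      by (intro validI[of "[]" "[]"]) (auto simp: is_path_def path_lab_def turn_lab_def)
  next
    assume "t = Next k"
    then show ?thesis using assms(2) k
      by (intro validI[of "[]" "[]"]) (auto simp: is_path_def path_lab_def start_lab_def exit_lab_def)
  qed
qed

lemma valid_states:
  "valid P x \<Longrightarrow> copy x < 4 \<and> src x \<in> {0, 1, 2} \<and> tgt x \<in> {1, 2, 3} \<and> src x \<le> tgt x \<and> \<not> wound x"
  unfolding valid_def by blast

lemma valid_attach_two:
  assumes "valid P x" "valid P y" "matched x y"
  shows "valid P (Item (copy x) (src x) (fst (lab x) @ fst (lab y), snd (lab x) @ snd (lab y)) (tgt y) False)"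
proof -
  obtain I J where x: "is_path P x I J" using assms(1) unfolding valid_def by blast
  obtain I' J' where y: "is_path P y I' J'" using assms(2) unfolding valid_def by blast
  let ?w = "Item (copy x) (src x) (fst (lab x) @ fst (lab y), snd (lab x) @ snd (lab y)) (tgt y) False"
  have m: "copy y = copy x" "src y = tgt x" using assms(3) by (simp_all add: matched_def)
  have s: "copy x < 4" "src x \<in> {0, 1, 2}" "src x \<le> tgt x" "tgt y \<in> {1, 2, 3}" "tgt x \<le> tgt y"
    using valid_states[OF assms(1)] valid_states[OF assms(2)] m by auto
  have tx: "tgt x = 1 \<or> tgt x = 2"
    using valid_states[OF assms(1)] valid_states[OF assms(2)] m by auto
  have J: "tgt x = 1 \<Longrightarrow> J = []" and I': "tgt x = 2 \<Longrightarrow> I' = []"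
    using x y m by (simp_all add: is_path_def)
  \<comment> \<open>The order \<open>J' @ J\<close> comes from the reversal in \<open>winv\<close>.
    At inner state 1 the list J is empty, at inner state 2 the list I' is, so no factors have to be
    interchanged.\<close>
  have "lab ?w = path_lab P (copy x) (src x) (tgt y) (I @ I') (J' @ J)"
  proof -
    have "lab x = path_lab P (copy x) (src x) (tgt x) I J" "lab y = path_lab P (copy x) (tgt x) (tgt y) I' J'"
      using x y m by (simp_all add: is_path_def)
    then show ?thesis using tx
    proof (elim disjE)
      assume "tgt x = 1"
      then show ?thesis using s J \<open>lab x = _\<close> \<open>lab y = _\<close>
        by (simp add: path_lab_def spell_append index_word_append)
    next
      assume "tgt x = 2"
      then show ?thesis using s I' \<open>lab x = _\<close> \<open>lab y = _\<close>
        by (simp add: path_lab_def spell_append index_word_append winv_append)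
    qed
  qed
  moreover have "src x = tgt y \<longrightarrow> (I @ I') @ J' @ J \<noteq> []"
    using x s m by (auto simp: is_path_def)
  moreover have "src x = 2 \<longrightarrow> I @ I' = []" "tgt y = 1 \<longrightarrow> J' @ J = []"
    using x y s m tx J I' by (auto simp: is_path_def)
  ultimately have "is_path P ?w (I @ I') (J' @ J)"
    using x y unfolding is_path_def item.sel by auto
  then show ?thesis using s unfolding valid_def item.sel by auto
qed

lemma letter_in_copy: "k < 4 \<Longrightarrow> 8 + 4 * s + k \<in> copy_letters k"
  unfolding copy_letters_def mem_Collect_eq by presburger

lemma fst_spell: "k < 4 \<Longrightarrow> fst ` set (spell k w) \<subseteq> copy_letters k"
  unfolding spell_def pos_def by (auto intro: letter_in_copy)

lemma fst_index_word: "k < 4 \<Longrightarrow> fst ` set (index_word k I) \<subseteq> copy_letters k"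
  unfolding index_word_def index_letter_def pos_def
  by (auto intro: letter_in_copy)

lemma fst_set_winv: "fst ` set (winv w) = fst ` set w"
  by (simp add: winv_def image_image)

lemma fst_set_append: "fst ` set u \<subseteq> A \<Longrightarrow> fst ` set v \<subseteq> A \<Longrightarrow> fst ` set (u @ v) \<subseteq> A"
  by auto

lemma fst_set_if: "fst ` set u \<subseteq> A \<Longrightarrow> fst ` set (if c then u else []) \<subseteq> A"
  by auto

lemma esum_winv: "esum (winv w) = - esum w"
  by (induction w) (auto simp: winv_Cons winv_def[of "[]"])

lemma esum_index_word: "esum (index_word k I) = int (length I)"
  by (induction I) (auto simp: index_word_def pos_def)

lemma valid_wf_item:
  assumes "valid P x" "(c, m) \<in> {(fst, 1), (snd, - 1)}"
  shows "wf_item m (map_item c x)"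
proof -
  obtain I J where "is_path P x I J"
    using assms(1) unfolding valid_def by blast
  then have x: "src x = 2 \<longrightarrow> I = []" "tgt x = 1 \<longrightarrow> J = []" "src x = tgt x \<longrightarrow> I @ J \<noteq> []"
    and l: "lab x = path_lab P (copy x) (src x) (tgt x) I J"
    unfolding is_path_def by blast+
  note s = valid_states[OF assms(1)]
  then have L: "fst ` set (spell (copy x) w) \<subseteq> copy_letters (copy x)"
      "fst ` set (winv (spell (copy x) w)) \<subseteq> copy_letters (copy x)"
      "fst ` set (index_word (copy x) I) \<subseteq> copy_letters (copy x)"
      "fst ` set (winv (index_word (copy x) I)) \<subseteq> copy_letters (copy x)" for w I
    by (simp_all add: fst_set_winv fst_spell fst_index_word)
  have "fst ` set (fst (lab x)) \<subseteq> copy_letters (copy x)" "fst ` set (snd (lab x)) \<subseteq> copy_letters (copy x)"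
    unfolding l path_lab_def start_lab_def turn_lab_def exit_lab_def fst_conv snd_conv
    by (intro fst_set_append fst_set_if L)+
  moreover have "esum (snd (lab x)) = int (length I) - int (length J)"
    unfolding l path_lab_def by (simp add: esum_winv esum_index_word)
  ultimately show ?thesis
    using assms(2) x s unfolding wf_item_def by (auto simp: item.map_sel)
qed

text \<open>The second component equates two positive index words, so I = J; with a common index
  sequence the first component equates the two concatenations of the instance.\<close>

lemma complete_valid_solution:
  assumes "valid P x" "src x = 0" "tgt x = 3" "fred (fst (lab x)) = []" "fred (snd (lab x)) = []"
  shows "RPCP P"
proof -
  have inj: "inj (\<lambda>g. 4 * (2 + enc_gen g) + k)" for k
    by (auto simp: inj_def enc_gen_def split: gen.splits)
  obtain I J where I: "set I \<subseteq> {1..<length P - 1}"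
    and l: "fst (lab x) = fst (start_lab P (copy x)) @ spell (copy x) (concat (map (\<lambda>i. fst (P ! i)) I)) @
        fst (turn_lab P (copy x)) @ winv (spell (copy x) (concat (map (\<lambda>i. snd (P ! i)) J))) @
        fst (exit_lab P (copy x))"
      "snd (lab x) = index_word (copy x) I @ winv (index_word (copy x) J)"
    using assms(1-3) by (auto simp: valid_def is_path_def path_lab_def)
  have "map (index_letter (copy x)) I = map (index_letter (copy x)) J"
    using assms(5) unfolding l(2) index_word_def by (rule pos_winv_pos_trivial)
  then have "I = J" by (rule map_injective) (simp add: inj_def index_letter_def)
  let ?u = "fst (P ! 0) @ concat (map (\<lambda>i. fst (P ! i)) I) @ fst (P ! (length P - 1))"
  let ?v = "snd (P ! 0) @ concat (map (\<lambda>i. snd (P ! i)) I) @ snd (P ! (length P - 1))"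
  have "fst (lab x) = spell (copy x) ?u @ winv (spell (copy x) ?v)"
    using \<open>I = J\<close> unfolding l(1)
    by (simp add: start_lab_def turn_lab_def exit_lab_def spell_append winv_append)
  then have "?u = ?v"
    using assms(4) pos_winv_pos_trivial map_injective[OF _ inj] unfolding spell_def by metis
  moreover have "1 \<le> l \<and> l \<le> length P - 2" if "l \<in> set I" for l
    using subsetD[OF I that] by auto
  ultimately show ?thesis unfolding RPCP_def by (intro exI[of _ I]) simp
qed

section \<open>Comparing the two scores of a merged list\<close>

lemma item_word_attach_two:
  assumes "matched x y" "c \<in> {fst, snd}"
  shows "fred (item_word (map_item c (Item (copy x) (src x)
      (fst (lab x) @ fst (lab y), snd (lab x) @ snd (lab y)) (tgt y) False))) =
    fred (item_word (map_item c x) @ item_word (map_item c y))"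
  using assms border_glue[of "copy x" "src x" "c (lab x)" "tgt x"
      "c (lab y) @ border (copy x) (tgt y) True", symmetric]
  by (auto simp: matched_def item_word_def item.map_sel)

lemma foldr_attach:
  assumes "xs \<noteq> []" "\<forall>x \<in> set xs. valid P x" "successively linked xs"
  defines "ys \<equiv> foldr attach xs []"
  shows "ys \<noteq> [] \<and> (\<forall>y \<in> set ys. valid P y) \<and> successively (\<lambda>x y. linked x y \<and> \<not> matched x y) ys \<and>
    src (hd ys) = src (hd xs) \<and> copy (hd ys) = copy (hd xs) \<and> tgt (last ys) = tgt (last xs) \<and>
    (\<forall>c \<in> {fst, snd}. fred (list_word (map (map_item c) ys)) = fred (list_word (map (map_item c) xs)))"
  using assms(1-3) unfolding ys_def
proof (induction xs)
  case (Cons x xs)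
  show ?case
  proof (cases "xs = []")
    case True
    then show ?thesis using Cons.prems by simp
  next
    case False
    define zs where "zs = foldr attach xs []"
    have IH: "zs \<noteq> []" "\<forall>y \<in> set zs. valid P y" "successively (\<lambda>x y. linked x y \<and> \<not> matched x y) zs"
      "src (hd zs) = src (hd xs)" "copy (hd zs) = copy (hd xs)" "tgt (last zs) = tgt (last xs)"
      "\<forall>c \<in> {fst, snd}. fred (list_word (map (map_item c) zs)) = fred (list_word (map (map_item c) xs))"
      using Cons.IH False Cons.prems by (auto simp: zs_def successively_Cons)
    obtain z zs' where zs: "zs = z # zs'" using IH(1) by (cases zs) auto
    have vx: "valid P x" and vz: "valid P z" using Cons.prems IH(2) zs by auto
    have link: "linked x z"
      using Cons.prems False IH(4,5) by (auto simp: zs successively_Cons linked_def compatible_def)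
    show ?thesis
    proof (cases "matched x z")
      case True
      let ?w = "Item (copy x) (src x) (fst (lab x) @ fst (lab z), snd (lab x) @ snd (lab z)) (tgt z) False"
      have eq: "foldr attach (x # xs) [] = ?w # zs'" using True by (simp add: zs_def[symmetric] zs)
      have "successively (\<lambda>x y. linked x y \<and> \<not> matched x y) (?w # zs')"
      proof -
        have "linked ?w v \<longleftrightarrow> linked z v" "matched ?w v \<longleftrightarrow> matched z v" for v :: "(word \<times> word) item"
          using True by (simp_all add: linked_def matched_def compatible_def)
        then show ?thesis using IH(3) by (cases zs') (simp_all add: zs)
      qed
      moreover have "valid P ?w" using valid_attach_two[OF vx vz True] .
      moreover have "tgt (last (?w # zs')) = tgt (last (x # xs))"
        using IH(6) False by (cases zs') (auto simp: zs)
      moreover have "fred (list_word (map (map_item c) (?w # zs'))) =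
          fred (list_word (map (map_item c) (x # xs)))" if c: "c \<in> {fst, snd}" for c
      proof -
        have "fred (list_word (map (map_item c) (?w # zs'))) =
          fred ((item_word (map_item c x) @ item_word (map_item c z)) @ list_word (map (map_item c) zs'))"
          unfolding list.map list_word_simps
          by (intro fred_append_cong refl item_word_attach_two[OF True c])
        also have "\<dots> = fred (item_word (map_item c x) @ list_word (map (map_item c) zs))"
          by (simp add: zs)
        also have "\<dots> = fred (item_word (map_item c x) @ list_word (map (map_item c) xs))"
          using IH(7) c by (intro fred_append_cong refl) blast
        finally show ?thesis by simp
      qed
      ultimately show ?thesis unfolding eq using IH(2) by (auto simp: zs)
    next
      case nm: False
      then have eq: "foldr attach (x # xs) [] = x # zs" by (simp add: zs_def[symmetric] zs)
      have "fred (list_word (map (map_item c) (x # zs))) = fred (list_word (map (map_item c) (x # xs)))"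
        if "c \<in> {fst, snd}" for c
        unfolding list.map list_word_simps using IH(7) that by (intro fred_append_cong refl) blast
      then show ?thesis unfolding eq using IH vx link nm False by (auto simp: zs)
    qed
  qed
qed simp

text \<open>No item is wound yet, so only complete items score. Without a solution none is trivial
  in both components, hence at least one of its scores is -1.\<close>

lemma item_scores_sum:
  assumes "valid P x" "\<not> RPCP P"
  shows "item_score (map_item fst x) + item_score (map_item snd x) \<le> 0"
  using complete_valid_solution[OF assms(1)] assms(2) valid_states[OF assms(1)]
  by (auto simp: item_score_def trivial_def item.map_sel)

text \<open>An open gap leads to the next copy and is worth 0 in both components; any other gap is a
  mismatch, worth 1 and -1.\<close>

lemma gap_scores_sum:
  assumes "linked x y" "\<not> matched x y" "copy x < 4"
  shows "gap_score 1 (map_item f x) (map_item f y) + gap_score (- 1) (map_item g x) (map_item g y) = 0"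
proof (cases "tgt x = 3")
  case True
  then have "copy y = Suc (copy x) mod 4" using assms(1) by (simp add: linked_def)
  then have "(int (copy y) - int (copy x) - 1) mod 4 = 0" by presburger
  then show ?thesis using True by (simp add: gap_score_def item.map_sel)
qed (use assms in \<open>auto simp: gap_score_def joinable_def matched_def item.map_sel\<close>)

lemma scores_sum:
  assumes "\<forall>x \<in> set xs. valid P x" "successively (\<lambda>x y. linked x y \<and> \<not> matched x y) xs" "\<not> RPCP P"
  shows "score 1 (map (map_item fst) xs) + score (- 1) (map (map_item snd) xs) \<le> 0"
  using assms(1,2)
proof (induction xs rule: induct_list012)
  case (2 x)
  then show ?case using item_scores_sum[OF _ assms(3)] by simp
next
  case (3 x y zs)
  then show ?case
    using item_scores_sum[OF _ assms(3), of x] gap_scores_sum[of x y fst snd] valid_states[of P x]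
    by simp
qed simp

lemma identity_imp_RPCP:
  assumes "ICP (icp_of P)"
  shows "RPCP P"
proof (rule ccontr)
  assume no: "\<not> RPCP P"
  obtain ts where ts: "ts \<noteq> []" "set ts \<subseteq> set (tiles (length P))"
    and triv: "\<forall>c \<in> {fst, snd}. fred (concat (map (tile_word c P) ts)) = []"
    using assms unfolding ICP_icp_of by blast
  define xs where "xs = concat (map (tile_items P) ts)"
  have ne: "tile_items P t \<noteq> []" "src (hd (tile_items P t)) \<in> {1, 2}" "tgt (last (tile_items P t)) \<in> {1, 2}"
    "successively linked (tile_items P t)" for t
    by (cases t; simp add: linked_def compatible_def)+
  have xs1: "xs \<noteq> []" using ts(1) ne(1) by (cases ts) (auto simp: xs_def)
  have xs2: "\<forall>x \<in> set xs. valid P x" using ts(2) valid_tile_items by (auto simp: xs_def)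
  have xs3: "successively linked xs"
    unfolding xs_def
  proof (rule successively_concat)
    show "successively (\<lambda>u v. linked (last u) (hd v)) (map (tile_items P) ts)"
    proof -
      \<comment> \<open>All tiles have closed outer ends, so any tile sequence is linked; open gaps
        occur only inside \<open>Next\<close> tiles.\<close>
      have "linked (last (tile_items P t)) (hd (tile_items P t'))" for t t'
        using ne(2)[of t'] ne(3)[of t] by (auto simp: linked_def compatible_def)
      then show ?thesis by (simp add: successively_conv_nth)
    qed
  qed (use ne in auto)
  have hd: "src (hd xs) \<noteq> 0"
    using ts(1) ne(1) ne(2)[of "hd ts"] by (cases ts) (auto simp: xs_def)
  have "tgt (last xs) \<noteq> 3"
    using ts(1) ne(1) ne(3)[of "last ts"] by (cases ts rule: rev_cases) (auto simp: xs_def)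
  define ys where "ys = foldr attach xs []"
  note ys = foldr_attach[OF xs1 xs2 xs3, folded ys_def]
  have "wf_list m (map (map_item c) ys) \<and> fred (list_word (map (map_item c) ys)) = []"
    if cm: "(c, m) \<in> {(fst, 1), (snd, - 1)}" for c m
  proof
    have "successively compatible (map (map_item c) ys)"
      using ys by (auto simp: successively_conv_nth linked_def compatible_def item.map_sel)
    then show "wf_list m (map (map_item c) ys)"
      using ys valid_wf_item[OF _ cm] hd \<open>tgt (last xs) \<noteq> 3\<close>
      by (auto simp: wf_list_def hd_map last_map item.map_sel)
    have "list_word (map (map_item c) xs) = concat (map (tile_word c P) ts)"
      unfolding xs_def tile_word_def by (induction ts) auto
    then show "fred (list_word (map (map_item c) ys)) = []"
      using cm triv ys by auto
  qed
  from this[of fst 1] this[of snd "- 1"]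
  have "0 \<le> score 1 (map (map_item fst) ys)" "3 \<le> score (- 1) (map (map_item snd) ys)"
    using score_bound[of 1 "map (map_item fst) ys"] score_bound[of "- 1" "map (map_item snd) ys"]
    by auto
  moreover have "score 1 (map (map_item fst) ys) + score (- 1) (map (map_item snd) ys) \<le> 0"
    using ys no by (intro scores_sum) auto
  ultimately show False by linarith
qed

section \<open>Computable functions\<close>

definition computable :: "nat \<Rightarrow> (nat list \<Rightarrow> nat) \<Rightarrow> bool" where
  "computable n F \<longleftrightarrow> (\<exists>r. \<forall>xs. length xs = n \<longrightarrow> eval r xs (F xs))"

lemma computable_cong:
  assumes "computable n F" "\<And>xs. length xs = n \<Longrightarrow> F xs = G xs"
  shows "computable n G"
  using assms unfolding computable_def by metis

lemma computable_nth: "i < n \<Longrightarrow> computable n (\<lambda>xs. xs ! i)"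
  unfolding computable_def by (metis eval_Id)

lemma computable_compose:
  assumes "computable (length Gs) F" "\<forall>G \<in> set Gs. computable n G"
  shows "computable n (\<lambda>xs. F (map (\<lambda>G. G xs) Gs))"
proof -
  obtain f where f: "\<And>ys. length ys = length Gs \<Longrightarrow> eval f ys (F ys)"
    using assms(1) unfolding computable_def by blast
  obtain r where r: "\<And>G xs. G \<in> set Gs \<Longrightarrow> length xs = n \<Longrightarrow> eval (r G) xs (G xs)"
    using assms(2) unfolding computable_def by metis
  have "eval (Cn f (map r Gs)) xs (F (map (\<lambda>G. G xs) Gs))" if "length xs = n" for xs
    by (rule eval_Cn[where ys = "map (\<lambda>G. G xs) Gs"]) (use f r that in auto)
  then show ?thesis unfolding computable_def by blast
qed

abbreviation computable1 :: "(nat \<Rightarrow> nat) \<Rightarrow> bool" where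
  "computable1 f \<equiv> computable 1 (\<lambda>xs. f (xs ! 0))"

abbreviation computable2 :: "(nat \<Rightarrow> nat \<Rightarrow> nat) \<Rightarrow> bool" where
  "computable2 f \<equiv> computable 2 (\<lambda>xs. f (xs ! 0) (xs ! 1))"

abbreviation computable3 :: "(nat \<Rightarrow> nat \<Rightarrow> nat \<Rightarrow> nat) \<Rightarrow> bool" where
  "computable3 f \<equiv> computable 3 (\<lambda>xs. f (xs ! 0) (xs ! 1) (xs ! 2))"

lemma computable_app1: "computable1 f \<Longrightarrow> computable n A \<Longrightarrow> computable n (\<lambda>xs. f (A xs))"
  using computable_compose[of "[A]" "\<lambda>xs. f (xs ! 0)" n] by simp

lemma computable_app2:
  "computable2 f \<Longrightarrow> computable n A \<Longrightarrow> computable n B \<Longrightarrow> computable n (\<lambda>xs. f (A xs) (B xs))"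
  using computable_compose[of "[A, B]" "\<lambda>xs. f (xs ! 0) (xs ! 1)" n] by (simp add: numeral_2_eq_2)

lemma computable_Suc: "computable n A \<Longrightarrow> computable n (\<lambda>xs. Suc (A xs))"
proof (rule computable_app1[of Suc])
  show "computable1 Suc"
    unfolding computable_def
    by (intro exI[of _ S] allI impI) (auto simp: length_Suc_conv intro: eval_S)
qed

lemma computable_const: "computable n (\<lambda>_. c)"
proof (induction c)
  case 0
  show ?case unfolding computable_def by (blast intro: eval_Z)
qed (rule computable_Suc)

lemma computable_rec:
  assumes "computable1 g" "computable3 h"
  shows "computable2 (\<lambda>k y. rec_nat (g y) (\<lambda>j r. h r j y) k)"
proof -
  obtain f1 where f1: "\<And>y. eval f1 [y] (g y)"
    using assms(1) unfolding computable_def by (metis One_nat_def length_Cons list.size(3) nth_Cons_0)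
  obtain f2 where f2: "\<And>r j y. eval f2 [r, j, y] (h r j y)"
  proof -
    obtain f where "\<And>xs. length xs = 3 \<Longrightarrow> eval f xs (h (xs ! 0) (xs ! 1) (xs ! 2))"
      using assms(2) unfolding computable_def by blast
    from this[of "[_, _, _]"] show ?thesis using that by (auto simp: numeral_2_eq_2)
  qed
  have "eval (Pr f1 f2) [k, y] (rec_nat (g y) (\<lambda>j r. h r j y) k)" for k y
    by (induction k) (auto intro: eval_Pr0 eval_PrS f1 f2)
  then show ?thesis unfolding computable_def
    by (intro exI[of _ "Pr f1 f2"]) (auto simp: length_Suc_conv numeral_2_eq_2)
qed

lemma computable_least:
  assumes "computable2 t" "\<And>z. \<exists>k. t k z = 0"
  shows "computable1 (\<lambda>z. LEAST k. t k z = 0)"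
proof -
  obtain f where "\<And>xs. length xs = 2 \<Longrightarrow> eval f xs (t (xs ! 0) (xs ! 1))"
    using assms(1) unfolding computable_def by blast
  from this[of "[_, _]"] have f: "eval f [k, z] (t k z)" for k z by simp
  have "eval (Mn f) [z] (LEAST k. t k z = 0)" for z
  proof (rule eval_Mn)
    show "eval f [LEAST k. t k z = 0, z] 0"
      using f[of "LEAST k. t k z = 0" z] LeastI_ex[OF assms(2)[of z]] by simp
    show "\<forall>j < (LEAST k. t k z = 0). \<exists>y. eval f [j, z] y \<and> 0 < y"
      using f not_less_Least by blast
  qed
  then show ?thesis unfolding computable_def
    by (intro exI[of _ "Mn f"]) (auto simp: length_Suc_conv)
qed

lemma computable_proj3:
  "computable 3 (\<lambda>xs. xs ! 0)" "computable 3 (\<lambda>xs. xs ! 1)" "computable 3 (\<lambda>xs. xs ! 2)"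
  by (simp_all add: computable_nth)

lemma computable_proj2: "computable 2 (\<lambda>xs. xs ! 0)" "computable 2 (\<lambda>xs. xs ! 1)"
  by (simp_all add: computable_nth)

lemma computable_proj1: "computable 1 (\<lambda>xs. xs ! 0)"
  by (simp add: computable_nth)

section \<open>Arithmetic and case distinction\<close>

lemma computable_add: "computable n A \<Longrightarrow> computable n B \<Longrightarrow> computable n (\<lambda>xs. A xs + B xs)"
proof (rule computable_app2[of "(+)"])
  have "rec_nat y (\<lambda>j r. Suc r) k = k + y" for k y by (induction k) auto
  moreover have "computable2 (\<lambda>k y. rec_nat y (\<lambda>j r. Suc r) k)"
    by (intro computable_rec computable_Suc computable_proj1 computable_proj3)
  ultimately show "computable2 (+)" by simp
qed

lemma computable_pred: "computable n A \<Longrightarrow> computable n (\<lambda>xs. A xs - 1)"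
proof (rule computable_app1[of "\<lambda>x. x - 1"])
  have "rec_nat 0 (\<lambda>j r. j) k = k - 1" for k by (cases k) auto
  moreover have "computable2 (\<lambda>k y. rec_nat 0 (\<lambda>j r. j) k)"
    by (intro computable_rec computable_const computable_proj3)
  ultimately have "computable2 (\<lambda>k y. k - 1)" by simp
  from computable_app2[OF this computable_proj1 computable_proj1]
  show "computable1 (\<lambda>x. x - 1)" .
qed

lemma computable_diff: "computable n A \<Longrightarrow> computable n B \<Longrightarrow> computable n (\<lambda>xs. A xs - B xs)"
proof (rule computable_app2[of "\<lambda>x y. x - y"])
  have "rec_nat y (\<lambda>j r. r - 1) k = y - k" for k y by (induction k) auto
  moreover have "computable2 (\<lambda>k y. rec_nat y (\<lambda>j r. r - 1) k)"
    by (intro computable_rec computable_pred computable_proj1 computable_proj3)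
  ultimately have "computable2 (\<lambda>k y. y - k)" by simp
  from computable_app2[OF this computable_proj2(2) computable_proj2(1)]
  show "computable2 (\<lambda>x y. x - y)" .
qed

lemma computable_if_zero:
  assumes "computable n C" "computable n A" "computable n B"
  shows "computable n (\<lambda>xs. if C xs = 0 then A xs else B xs)"
proof -
  have test: "computable2 (\<lambda>k y. if k = 0 then y else 0)"
  proof -
    have "rec_nat y (\<lambda>j r. 0) k = (if k = 0 then y else 0)" for k y :: nat by (cases k) auto
    moreover have "computable2 (\<lambda>k y. rec_nat y (\<lambda>j r. 0) k)"
      by (intro computable_rec computable_const computable_proj1)
    ultimately show ?thesis by (simp only:)
  qed
  have "computable n (\<lambda>xs. (if C xs = 0 then A xs else 0) + (if 1 - C xs = 0 then B xs else 0))"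
    by (intro computable_add computable_app2[OF test] computable_diff computable_const assms)
  then show ?thesis by (rule computable_cong) auto
qed

lemma computable_if_eq:
  assumes "computable n C" "computable n D" "computable n A" "computable n B"
  shows "computable n (\<lambda>xs. if C xs = D xs then A xs else B xs)"
proof -
  have "computable n (\<lambda>xs. if (C xs - D xs) + (D xs - C xs) = 0 then A xs else B xs)"
    by (intro computable_if_zero computable_add computable_diff assms)
  then show ?thesis by (rule computable_cong) auto
qed

lemma computable_funpow:
  assumes "computable1 f"
  shows "computable2 (\<lambda>k x. (f ^^ k) x)"
proof -
  have "rec_nat x (\<lambda>j r. f r) k = (f ^^ k) x" for k x by (induction k) auto
  moreover have "computable2 (\<lambda>k y. rec_nat y (\<lambda>j r. f r) k)"
    by (intro computable_rec computable_app1[OF assms] computable_proj1 computable_proj3)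
  ultimately show ?thesis by (simp only:)
qed

lemma computable_triangle: "computable n A \<Longrightarrow> computable n (\<lambda>xs. triangle (A xs))"
proof (rule computable_app1[of triangle])
  have "rec_nat 0 (\<lambda>j r. r + Suc j) k = triangle k" for k by (induction k) auto
  moreover have "computable2 (\<lambda>k y. rec_nat 0 (\<lambda>j r. r + Suc j) k)"
    by (intro computable_rec computable_const computable_add computable_Suc computable_proj3)
  ultimately have "computable2 (\<lambda>k y. triangle k)" by (simp only:)
  from computable_app2[OF this computable_proj1 computable_proj1]
  show "computable1 triangle" .
qed

section \<open>The pairing function and its projections\<close>

lemma computable_prod_encode:
  "computable n A \<Longrightarrow> computable n B \<Longrightarrow> computable n (\<lambda>xs. prod_encode (A xs, B xs))"
  unfolding prod_encode_def prod.case by (intro computable_add computable_triangle)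

definition pfst :: "nat \<Rightarrow> nat" where "pfst z = fst (prod_decode z)"
definition psnd :: "nat \<Rightarrow> nat" where "psnd z = snd (prod_decode z)"

lemma pfst_psnd_encode [simp]: "pfst (prod_encode (x, y)) = x" "psnd (prod_encode (x, y)) = y"
  by (simp_all add: pfst_def psnd_def)

text \<open>As \<open>prod_encode (x, y)\<close> is \<open>triangle (x + y) + x\<close>, the
  diagonal x + y is the least k with z below \<open>triangle (Suc k)\<close>. Truncated subtraction
  turns this comparison into a zero test for minimisation.\<close>

definition diagonal :: "nat \<Rightarrow> nat" where
  "diagonal z = (LEAST k. Suc z - triangle (Suc k) = 0)"

lemma diagonal_encode: "diagonal (prod_encode (x, y)) = x + y"
  unfolding diagonal_def
proof (rule Least_equality)
  show "Suc (prod_encode (x, y)) - triangle (Suc (x + y)) = 0"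
    by (simp add: prod_encode_def)
  fix k assume k: "Suc (prod_encode (x, y)) - triangle (Suc k) = 0"
  have mono: "i \<le> j \<Longrightarrow> triangle i \<le> triangle j" for i j
    by (induction j) (auto simp: le_Suc_eq)
  show "x + y \<le> k"
  proof (rule ccontr)
    assume "\<not> x + y \<le> k"
    then have "triangle (Suc k) \<le> triangle (x + y)" by (intro mono) simp
    then show False using k by (simp add: prod_encode_def)
  qed
qed

lemma computable_diagonal: "computable n A \<Longrightarrow> computable n (\<lambda>xs. diagonal (A xs))"
proof (rule computable_app1[of diagonal])
  show "computable1 diagonal"
    unfolding diagonal_def
  proof (rule computable_least)
    show "computable2 (\<lambda>k z. Suc z - triangle (Suc k))"
      by (intro computable_diff computable_Suc computable_triangle computable_proj2)
    have "k \<le> triangle k" for k by (induction k) auto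
    then show "\<exists>k. Suc z - triangle (Suc k) = 0" for z
      by (intro exI[of _ z]) (simp add: le_diff_conv del: triangle_Suc)
  qed
qed

lemma pfst_diagonal: "pfst z = z - triangle (diagonal z)"
  and psnd_diagonal: "psnd z = diagonal z - pfst z"
proof -
  obtain x y where "z = prod_encode (x, y)" by (metis prod_decode_inverse surj_pair)
  then show "pfst z = z - triangle (diagonal z)" "psnd z = diagonal z - pfst z"
    by (simp_all add: diagonal_encode) (simp add: prod_encode_def)
qed

lemma computable_pfst: "computable n A \<Longrightarrow> computable n (\<lambda>xs. pfst (A xs))"
  unfolding pfst_diagonal by (intro computable_diff computable_triangle computable_diagonal)

lemma computable_psnd: "computable n A \<Longrightarrow> computable n (\<lambda>xs. psnd (A xs))"
  unfolding psnd_diagonal by (intro computable_diff computable_diagonal computable_pfst)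

lemmas computable_intros =
  computable_proj1 computable_proj2 computable_proj3 computable_const computable_Suc computable_add
  computable_pred computable_diff computable_if_zero computable_if_eq computable_prod_encode
  computable_pfst computable_psnd

subsection \<open>Lists\<close>

definition code_hd :: "nat \<Rightarrow> nat" where "code_hd l = pfst (l - 1)"
definition code_tl :: "nat \<Rightarrow> nat" where "code_tl l = psnd (l - 1)"

lemma code_hd_tl [simp]:
  "code_hd (list_encode (x # xs)) = x" "code_tl (list_encode (x # xs)) = list_encode xs"
  by (simp_all add: code_hd_def code_tl_def)

lemma computable_code_hd: "computable n A \<Longrightarrow> computable n (\<lambda>xs. code_hd (A xs))"
  unfolding code_hd_def by (intro computable_pfst computable_pred)

lemma computable_code_tl: "computable n A \<Longrightarrow> computable n (\<lambda>xs. code_tl (A xs))"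
  unfolding code_tl_def by (intro computable_psnd computable_pred)

lemma computable_code_nth:
  assumes "computable n A"
  shows "computable n (\<lambda>xs. code_hd ((code_tl ^^ i) (A xs)))"
proof -
  have "computable n (\<lambda>xs. (code_tl ^^ i) (A xs))"
    by (induction i) (auto intro: assms computable_code_tl)
  then show ?thesis by (rule computable_code_hd)
qed

lemma code_nth: "i < length xs \<Longrightarrow> code_hd ((code_tl ^^ i) (list_encode xs)) = xs ! i"
proof (induction i arbitrary: xs)
  case 0
  then show ?case by (cases xs) (auto simp del: list_encode.simps)
next
  case (Suc i)
  then show ?case by (cases xs) (auto simp: funpow_swap1 simp del: list_encode.simps)
qed

lemma length_le_list_encode: "length xs \<le> list_encode xs"
proof (induction xs)
  case (Cons x xs)
  then show ?case using le_prod_encode_2[of "list_encode xs" x] by simp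
qed simp

text \<open>The state pairs the accumulator with the code of the remaining list. The code 0 of the
  empty list makes the step stationary, so surplus iterations do no harm.\<close>

definition fold_step :: "(nat \<Rightarrow> nat \<Rightarrow> nat) \<Rightarrow> nat \<Rightarrow> nat" where
  "fold_step f z = (if psnd z = 0 then z
     else prod_encode (f (pfst z) (code_hd (psnd z)), code_tl (psnd z)))"

lemma fold_step_iterate:
  "length xs \<le> k \<Longrightarrow> (fold_step f ^^ k) (prod_encode (r, list_encode xs)) = prod_encode (foldl f r xs, 0)"
proof (induction k arbitrary: r xs)
  case (Suc k)
  show ?case
  proof (cases xs)
    case Nil
    then show ?thesis using Suc(1)[of "[]" r] by (simp add: funpow_swap1 fold_step_def)
  next
    case (Cons x ys)
    have "fold_step f (prod_encode (r, list_encode xs)) = prod_encode (f r x, list_encode ys)"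
      by (simp add: Cons fold_step_def del: list_encode.simps) simp
    then show ?thesis using Suc Cons by (simp add: funpow_swap1)
  qed
qed simp

lemma computable_foldl:
  assumes "computable2 f" "computable n A" "computable n B"
  shows "computable n (\<lambda>xs. foldl f (A xs) (list_decode (B xs)))"
proof -
  have "computable1 (fold_step f)"
    unfolding fold_step_def
    by (intro computable_if_zero computable_intros computable_app2[OF assms(1)]
        computable_code_hd computable_code_tl)
  \<comment> \<open>The list code itself is the number of iterations, being at least the
    length.\<close>
  from computable_app2[OF computable_funpow[OF this] assms(3) computable_prod_encode[OF assms(2,3)]]
  have "computable n (\<lambda>xs. pfst ((fold_step f ^^ B xs) (prod_encode (A xs, B xs))))"
    by (rule computable_pfst)
  then show ?thesis
  proof (rule computable_cong)
    fix xs
    show "pfst ((fold_step f ^^ B xs) (prod_encode (A xs, B xs))) = foldl f (A xs) (list_decode (B xs))"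
      using fold_step_iterate[of "list_decode (B xs)" "B xs" f "A xs"]
        length_le_list_encode[of "list_decode (B xs)"] by simp
  qed
qed

lemma computable_list:
  assumes "\<And>f. f \<in> set fs \<Longrightarrow> computable n f"
  shows "computable n (\<lambda>xs. list_encode (map (\<lambda>f. f xs) fs))"
  using assms by (induction fs) (auto intro!: computable_const computable_Suc computable_prod_encode)

subsection \<open>Computability of the reduction\<close>

definition enc_word :: "letter list \<Rightarrow> nat" where
  "enc_word w = list_encode (map enc_letter w)"

definition enc_gens :: "gen list \<Rightarrow> nat" where
  "enc_gens u = list_encode (map enc_gen u)"

text \<open>For fixed n the list of tiles is fixed, so the reduction splits into finitely many
  functions of the instance code, one for each component of each tile.\<close>

definition represents :: "nat \<Rightarrow> ('v \<Rightarrow> nat) \<Rightarrow> (pcp_instance \<Rightarrow> 'v) \<Rightarrow> bool" where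
  "represents n enc F \<longleftrightarrow> (\<exists>G. computable1 G \<and> (\<forall>P. length P = n \<longrightarrow> G (enc_pcp P) = enc (F P)))"

lemma represents_cong:
  "(\<And>P. length P = n \<Longrightarrow> F P = F' P) \<Longrightarrow> represents n enc F \<longleftrightarrow> represents n enc F'"
  by (simp add: represents_def)

lemma represents_const: "represents n enc (\<lambda>_. c)"
  unfolding represents_def by (intro exI[of _ "\<lambda>_. enc c"]) (simp add: computable_const)

lemma represents_comp:
  assumes "represents n enc F" "computable1 f" "\<And>v. f (enc v) = enc' (g v)"
  shows "represents n enc' (\<lambda>P. g (F P))"
proof -
  obtain G where G: "computable1 G" "\<And>P. length P = n \<Longrightarrow> G (enc_pcp P) = enc (F P)"
    using assms(1) unfolding represents_def by blast
  then show ?thesis unfolding represents_def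
    using computable_app1[OF assms(2) G(1)] assms(3) by (intro exI[of _ "\<lambda>z. f (G z)"]) simp
qed

section \<open>Operations on codes of words\<close>

lemma represents_component:
  assumes "i < n"
  shows "represents n enc_gens (\<lambda>P. fst (P ! i))" "represents n enc_gens (\<lambda>P. snd (P ! i))"
proof -
  let ?G = "\<lambda>z. code_hd ((code_tl ^^ i) z)"
  have "?G (enc_pcp P) = prod_encode (enc_gens (fst (P ! i)), enc_gens (snd (P ! i)))" if "length P = n" for P
    using code_nth[of i] assms that by (simp add: enc_pcp_def enc_gens_def case_prod_unfold)
  moreover have "computable1 ?G" by (intro computable_code_nth computable_proj1)
  ultimately show "represents n enc_gens (\<lambda>P. fst (P ! i))" "represents n enc_gens (\<lambda>P. snd (P ! i))"
    unfolding represents_def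
    by (intro exI[of _ "\<lambda>z. pfst (?G z)"] exI[of _ "\<lambda>z. psnd (?G z)"];
        simp add: computable_pfst computable_psnd)+
qed

text \<open>Reduced words are built by \<open>push\<close> from the right, so a positively spelled
  word has to be read from its last letter.\<close>

lemma represents_rev:
  assumes "represents n enc_gens U"
  shows "represents n enc_gens (\<lambda>P. rev (U P))"
proof (rule represents_comp[OF assms])
  let ?f = "\<lambda>z. foldl (\<lambda>r x. Suc (prod_encode (x, r))) 0 (list_decode z)"
  show "computable1 ?f"
    by (intro computable_foldl computable_Suc computable_prod_encode computable_const
        computable_proj1 computable_proj2)
  have "foldl (\<lambda>r x. Suc (prod_encode (x, r))) (list_encode ys) xs = list_encode (rev xs @ ys)" for xs ys
  proof (induction xs arbitrary: ys)
    case (Cons x xs)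
    then show ?case using Cons[of "x # ys"] by simp
  qed simp
  from this[of "[]"] show "?f (enc_gens u) = enc_gens (rev u)" for u
    by (simp add: enc_gens_def rev_map)
qed

text \<open>The test for 0 matters: \<open>code_hd 0\<close> is 0, which is also the code of the
  letter \<open>(a, False)\<close>, so an empty word would seem to begin with that letter.\<close>

definition push_code :: "letter \<Rightarrow> nat \<Rightarrow> nat" where
  "push_code x l = (if l = 0 then Suc (prod_encode (enc_letter x, l))
     else if code_hd l = enc_letter (fst x, \<not> snd x) then code_tl l
     else Suc (prod_encode (enc_letter x, l)))"

lemma enc_letter_eq_iff: "enc_letter x = enc_letter y \<longleftrightarrow> x = y"
  by (cases x; cases y) (auto simp: enc_letter_def enc_gen_def split: gen.splits if_splits)

lemma push_code_enc_word: "push_code x (enc_word w) = enc_word (push x w)"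
proof (cases w)
  case (Cons y v)
  have "enc_word w \<noteq> 0" "code_hd (enc_word w) = enc_letter y" "code_tl (enc_word w) = enc_word v"
    using code_hd_tl[of "enc_letter y" "map enc_letter v"] by (simp_all add: enc_word_def Cons)
  moreover have "push x w = (if y = (fst x, \<not> snd x) then v else x # w)"
    using Cons by (simp add: push_def)
  moreover have "enc_word (x # w) = Suc (prod_encode (enc_letter x, enc_word w))"
    by (simp add: enc_word_def)
  ultimately show ?thesis
    by (auto simp: push_code_def enc_letter_eq_iff)
qed (simp add: push_code_def push_def enc_word_def)

lemma foldr_push_code: "foldr push_code c (enc_word w) = enc_word (foldr push c w)"
  by (induction c) (auto simp: push_code_enc_word)

lemma computable_push_word: "computable n A \<Longrightarrow> computable n (\<lambda>xs. foldr push_code c (A xs))"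
proof (induction c)
  case (Cons x c)
  have "computable1 (push_code x)"
    unfolding push_code_def
    by (intro computable_if_zero computable_if_eq computable_Suc computable_prod_encode
        computable_code_hd computable_code_tl computable_const computable_proj1)
  then show ?case using computable_app1[OF _ Cons.IH[OF Cons.prems]] by simp
qed simp

lemma represents_push_word:
  assumes "represents n enc_word W"
  shows "represents n enc_word (\<lambda>P. foldr push c (W P))"
proof (rule represents_comp[OF assms])
  show "computable1 (foldr push_code c)"
    by (intro computable_push_word computable_proj1)
  show "foldr push_code c (enc_word v) = enc_word (foldr push c v)" for v
    by (rule foldr_push_code)
qed

text \<open>Each generator read from the instance contributes one of two constant words, so a fold
  that pushes constant words onto a reduced word suffices.\<close>

lemma represents_push_gens:
  assumes "represents n enc_gens U" "represents n enc_word W"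
  shows "represents n enc_word (\<lambda>P. foldl (\<lambda>r g. foldr push (c g) r) (W P) (U P))"
proof -
  let ?step = "\<lambda>r g. if g = 0 then foldr push_code (c a) r else foldr push_code (c b) r"
  obtain GU where U: "computable1 GU" "\<And>P. length P = n \<Longrightarrow> GU (enc_pcp P) = enc_gens (U P)"
    using assms(1) unfolding represents_def by blast
  obtain GW where W: "computable1 GW" "\<And>P. length P = n \<Longrightarrow> GW (enc_pcp P) = enc_word (W P)"
    using assms(2) unfolding represents_def by blast
  have step: "?step (enc_word w) (enc_gen g) = enc_word (foldr push (c g) w)" for w g
    by (cases g) (simp_all add: enc_gen_def foldr_push_code)
  have "foldl (\<lambda>r g. ?step r (enc_gen g)) (enc_word w) u =
      enc_word (foldl (\<lambda>r g. foldr push (c g) r) w u)" for w u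
    by (induction u arbitrary: w) (auto simp only: foldl.simps step)
  then have "foldl ?step (GW (enc_pcp P)) (list_decode (GU (enc_pcp P))) =
      enc_word (foldl (\<lambda>r g. foldr push (c g) r) (W P) (U P))" if "length P = n" for P
    using U(2) W(2) that by (simp add: enc_gens_def foldl_map)
  moreover have "computable1 (\<lambda>z. foldl ?step (GW z) (list_decode (GU z)))"
    by (intro computable_foldl computable_if_zero computable_push_word computable_proj2 U(1) W(1))
  ultimately show ?thesis unfolding represents_def
    by (intro exI[of _ "\<lambda>z. foldl ?step (GW z) (list_decode (GU z))"] conjI allI impI)
qed

definition represents_emb :: "nat \<Rightarrow> (pcp_instance \<Rightarrow> word) \<Rightarrow> bool" where
  "represents_emb n W \<longleftrightarrow> represents n enc_word (\<lambda>P. fred (emb (W P)))"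

lemma represents_emb_append:
  "represents_emb n W \<Longrightarrow> represents_emb n (\<lambda>P. c @ W P)"
  unfolding represents_emb_def emb_append fred_append by (rule represents_push_word)

lemma foldr_push_emb_spell:
  "foldr push (emb (spell k u)) w =
   foldl (\<lambda>r g. foldr push (emb1 (4 * (2 + enc_gen g) + k, False)) r) w (rev u)"
  by (induction u) (auto simp: spell_def pos_def emb_def)

lemma foldr_push_emb_winv_spell:
  "foldr push (emb (winv (spell k u))) w =
   foldl (\<lambda>r g. foldr push (emb1 (4 * (2 + enc_gen g) + k, True)) r) w u"
  by (induction u arbitrary: w) (auto simp: spell_def pos_def emb_def winv_def)

lemma represents_emb_spell:
  "represents n enc_gens U \<Longrightarrow> represents_emb n W \<Longrightarrow> represents_emb n (\<lambda>P. spell k (U P) @ W P)"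
  unfolding represents_emb_def emb_append fred_append foldr_push_emb_spell
  by (intro represents_push_gens represents_rev)

lemma represents_emb_winv_spell:
  "represents n enc_gens U \<Longrightarrow> represents_emb n W \<Longrightarrow> represents_emb n (\<lambda>P. winv (spell k (U P)) @ W P)"
  unfolding represents_emb_def emb_append fred_append foldr_push_emb_winv_spell
  by (intro represents_push_gens)

lemma represents_emb_const: "represents_emb n (\<lambda>_. w)"
  unfolding represents_emb_def by (rule represents_const)

lemma represents_tile_fst:
  assumes "t \<in> set (tiles n)" "n \<ge> 3"
  shows "represents_emb n (\<lambda>P. tile_word fst P t)"
proof -
  note intros = represents_emb_append represents_emb_spell represents_emb_winv_spell
    represents_component represents_emb_const
  have turn: "represents_emb n (\<lambda>P. tile_word fst P (Turn k))" for k
  proof -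
    \<comment> \<open>The turn label mentions \<open>length P - 1\<close>; on instances of length n
      this is a constant, so a fixed component of the code is read.\<close>
    have "represents_emb n (\<lambda>P. border k 1 False @ spell k (fst (P ! (n - 1))) @
        winv (spell k (snd (P ! (n - 1)))) @ border k 2 True)"
      using assms(2) by (intro intros) auto
    then show ?thesis
      unfolding represents_emb_def
      by (subst represents_cong) (auto simp: tile_word_def item_word_def turn_lab_def)
  qed
  show ?thesis
  proof (cases t)
    case (Up k i)
    have "represents_emb n (\<lambda>P. border k 1 False @ spell k (fst (P ! i)) @ border k 1 True)"
      using assms by (intro intros) (auto simp: Up set_tiles)
    then show ?thesis by (simp add: Up tile_word_def item_word_def up_lab_def)
  next
    case (Down k i)
    have "represents_emb n (\<lambda>P. border k 2 False @ winv (spell k (snd (P ! i))) @ border k 2 True)"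
      using assms by (intro intros) (auto simp: Down set_tiles)
    then show ?thesis by (simp add: Down tile_word_def item_word_def down_lab_def)
  next
    case (Next k)
    have "represents_emb n (\<lambda>P. border k 2 False @ winv (spell k (snd (P ! 0))) @
        spell (Suc k mod 4) (fst (P ! 0)) @ border (Suc k mod 4) 1 True)"
      using assms by (intro intros) auto
    moreover have "border k 3 e = []" "border k 0 e = []" for k e by (simp_all add: border_def)
    ultimately show ?thesis
      by (simp add: Next tile_word_def item_word_def start_lab_def exit_lab_def)
  qed (use turn in simp)
qed

text \<open>Second components record indices only and never the words of the instance, so they are
  constant; the empty instance serves as a representative.\<close>

lemma represents_tile_snd: "represents_emb n (\<lambda>P. tile_word snd P t)"
proof -
  have "(\<lambda>P. tile_word snd P t) = (\<lambda>_. tile_word snd [] t)"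
    by (cases t)
      (simp_all add: tile_word_def item_word_def start_lab_def up_lab_def turn_lab_def down_lab_def exit_lab_def)
  then show ?thesis by (simp only: represents_emb_const)
qed

lemma computable_reduction:
  assumes "n \<ge> 3"
  shows "\<exists>G. computable1 G \<and> (\<forall>P. length P = n \<longrightarrow> G (enc_pcp P) = enc_icp (icp_of P))"
proof -
  have "\<forall>t \<in> set (tiles n). \<exists>G. computable1 G \<and>
      (\<forall>P. length P = n \<longrightarrow> G (enc_pcp P) = enc_word (fred (emb (tile_word fst P t))))"
    using represents_tile_fst[OF _ assms] by (simp add: represents_emb_def represents_def)
  then obtain G1 where G1: "\<And>t. t \<in> set (tiles n) \<Longrightarrow> computable1 (G1 t)"
    "\<And>t P. t \<in> set (tiles n) \<Longrightarrow> length P = n \<Longrightarrow>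
      G1 t (enc_pcp P) = enc_word (fred (emb (tile_word fst P t)))"
    by metis
  have "\<forall>t. \<exists>G. computable1 G \<and>
      (\<forall>P. length P = n \<longrightarrow> G (enc_pcp P) = enc_word (fred (emb (tile_word snd P t))))"
    using represents_tile_snd by (simp add: represents_emb_def represents_def)
  then obtain G2 where G2: "\<And>t. computable1 (G2 t)"
    "\<And>t P. length P = n \<Longrightarrow> G2 t (enc_pcp P) = enc_word (fred (emb (tile_word snd P t)))"
    by metis
  define fs where "fs = map (\<lambda>t xs. prod_encode (G1 t (xs ! 0), G2 t (xs ! 0))) (tiles n)"
  have "computable 1 (\<lambda>xs. list_encode (map (\<lambda>f. f xs) fs))"
    by (rule computable_list) (auto simp: fs_def intro!: computable_prod_encode G1(1) G2(1) simp del: One_nat_def)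
  then have "computable1 (\<lambda>z. list_encode (map (\<lambda>t. prod_encode (G1 t z, G2 t z)) (tiles n)))"
    by (simp add: fs_def comp_def)
  moreover have "list_encode (map (\<lambda>t. prod_encode (G1 t (enc_pcp P), G2 t (enc_pcp P))) (tiles n)) =
      enc_icp (icp_of P)" if "length P = n" for P
    using that by (simp add: enc_icp_def icp_of_def comp_def enc_word_def[symmetric] red_eq_fred G1(2) G2(2)
        cong: map_cong)
  ultimately show ?thesis
    by (intro exI[of _ "\<lambda>z. list_encode (map (\<lambda>t. prod_encode (G1 t z, G2 t z)) (tiles n))"]
        conjI allI impI)
qed

section \<open>Transfer of decidability along the reduction\<close>

lemma decidable_on_reduction:
  assumes "decidable_on enc' D' Y'" "computable1 G"
    and "\<And>x. x \<in> D \<Longrightarrow> h x \<in> D' \<and> G (enc x) = enc' (h x) \<and> (Y' (h x) \<longleftrightarrow> Y x)"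
  shows "decidable_on enc D Y"
proof -
  obtain f where f: "\<And>x. x \<in> D' \<Longrightarrow> eval f [enc' x] (if Y' x then 1 else 0)"
    using assms(1) unfolding decidable_on_def by blast
  obtain r where "\<And>xs. length xs = 1 \<Longrightarrow> eval r xs (G (xs ! 0))"
    using assms(2) unfolding computable_def by blast
  from this[of "[_]"] have r: "eval r [z] (G z)" for z by simp
  have "eval (Cn f [r]) [enc x] (if Y x then 1 else 0)" if "x \<in> D" for x
    using f[of "h x"] r[of "enc x"] assms(3)[OF that]
    by (intro eval_Cn[where ys = "[G (enc x)]"]) auto
  then show ?thesis unfolding decidable_on_def by blast
qed

theorem mainTheorem4:
  fixes n :: nat
  assumes "n \<ge> 3"
    and "\<not> decidable_on enc_pcp (pcp_instances n) RPCP"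
  shows "\<not> decidable_on enc_icp (icp_instances (8 * (n - 1))) ICP"
proof
  assume dec: "decidable_on enc_icp (icp_instances (8 * (n - 1))) ICP"
  obtain G where "computable1 G" and G: "\<And>P. length P = n \<Longrightarrow> G (enc_pcp P) = enc_icp (icp_of P)"
    using computable_reduction[OF assms(1)] by blast
  then have "decidable_on enc_pcp (pcp_instances n) RPCP"
  proof (intro decidable_on_reduction[OF dec])
    fix P assume "P \<in> pcp_instances n"
    then have "length P = n" by (simp add: pcp_instances_def)
    then show "icp_of P \<in> icp_instances (8 * (n - 1)) \<and> G (enc_pcp P) = enc_icp (icp_of P) \<and>
        (ICP (icp_of P) \<longleftrightarrow> RPCP P)"
      using G icp_of_in_instances identity_imp_RPCP RPCP_imp_identity assms(1) by blast
  qed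
  then show False using assms(2) by blast
qed

end
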